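(* Let $B=\{x\in\mathbb{R}^4:|x_0|+|x_1|+|x_2|+|x_3|\le2\}$. For every unit vector $u\in\mathbb{R}^4$, $$\mathrm{vol}\bigl(B\cap\{x:\langle x,u\rangle\ge1\}\bigr)\ \le\ \tfrac13,$$ with equality if and only if $u=\pm e_k$ for some $k\in\{0,1,2,3\}$.
   Context: $e_0,e_1,e_2,e_3$ is the standard orthonormal basis of $\mathbb{R}^4$, with coordinates $x_0,\dots,x_3$; $\mathrm{vol}$ is Lebesgue measure. *)

theory Defs
  imports "HOL-Analysis.Analysis"
begin

text \<open>The index type \<^typ>\<open>4\<close> consists of the four distinct elements \<open>0, 1, 2, 3\<close>.\<close>

definition B :: "(real ^ 4) set"
  where "B = {x. \<bar>x $ 0\<bar> + \<bar>x $ 1\<bar> + \<bar>x $ 2\<bar> + \<bar>x $ 3\<bar> \<le> 2}"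

end

theory Submission
  imports Defs
begin

text \<open>The volume of the cap is computed exactly for normal vectors \<open>u\<close> with nonzero entries of distinct
  absolute values: with \<open>b\<^sub>i = u\<^sub>i\<^sup>2\<close> it is one third of the third divided difference at \<open>b\<^sub>0, \<dots>, b\<^sub>3\<close> of
  \<open>g(b) = b (2 \<surd>b - 1)\<^sub>+\<^sup>4\<close>. This comes from Fubini, by integrating truncated powers of affine
  functions over triangles, first over \<open>(x\<^sub>0, x\<^sub>1)\<close> and then over \<open>(x\<^sub>2, x\<^sub>3)\<close>.

  If all \<open>b\<^sub>i < 9/16\<close>, the inequality \<open>g''' \<le> 3 (8b - 1)\<^sup>2\<close> and the mean value theorem for divided
  differences bound the divided difference by \<open>1/10 + 8/5 \<Sum> b\<^sub>i\<^sup>2 < 1\<close>. If some \<open>b\<^sub>k = a\<^sup>2 \<ge> 9/16\<close>, only the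
  term of \<open>b\<^sub>k\<close> is positive, and it is at most \<open>(2a - 1)\<^sup>4 / (a\<^sup>2 (2a\<^sup>2 - 1)) \<le> 1\<close>, with equality only for
  \<open>a = 1\<close>. Degenerate \<open>u\<close> are reached as limits of generic ones; both bounds are continuous in \<open>u\<close>.\<close>

section \<open>Truncated powers: derivative and integral along a segment\<close>

text \<open>For \<open>k = 0\<close> this is the indicator of \<open>t \<ge> 0\<close>, unlike \<open>max 0 t ^ k\<close>.\<close>
definition tpow :: "nat \<Rightarrow> real \<Rightarrow> real"
  where "tpow k t = (if 0 \<le> t then t ^ k else 0)"

lemma tpow_nonneg [simp]: "0 \<le> tpow k t"
  by (simp add: tpow_def)

lemma tpow_Suc: "tpow (Suc k) t = max 0 t ^ Suc k"
  by (auto simp: tpow_def max_def)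

lemma continuous_on_tpow_Suc [continuous_intros]:
  "continuous_on A f \<Longrightarrow> continuous_on A (\<lambda>x. tpow (Suc k) (f x))"
  unfolding tpow_Suc by (intro continuous_intros)

lemma borel_measurable_tpow [measurable]: "tpow k \<in> borel_measurable borel"
  unfolding tpow_def[abs_def] by measurable

text \<open>The only bad point is the kink of \<open>tpow 1\<close> at 0, which the hypothesis
  excludes.\<close>

lemma has_real_derivative_tpow:
  assumes "t \<noteq> 0 \<or> 0 < k"
  shows "(tpow (Suc k) has_real_derivative Suc k * tpow k t) (at t)"
proof -
  consider "t < 0" | "t > 0" | "t = 0" "0 < k" using assms by linarith
  then show ?thesis
  proof cases
    case 1
    have "((\<lambda>_. 0) has_real_derivative 0) (at t)" by simp
    then have "(tpow (Suc k) has_real_derivative 0) (at t)"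
      by (rule has_field_derivative_transform_within_open[where S = "{..<0}"])
        (use 1 in \<open>auto simp: tpow_def\<close>)
    with 1 show ?thesis by (simp add: tpow_def)
  next
    case 2
    have "((\<lambda>t. t ^ Suc k) has_real_derivative Suc k * t ^ k) (at t)"
      using DERIV_pow[of "Suc k" t] by simp
    then have "(tpow (Suc k) has_real_derivative Suc k * t ^ k) (at t)"
      by (rule has_field_derivative_transform_within_open[where S = "{0<..}"])
        (use 2 in \<open>auto simp: tpow_def\<close>)
    with 2 show ?thesis by (simp add: tpow_def)
  next
    case 3
    \<comment> \<open>The difference quotient at 0 is \<open>tpow k\<close> itself, even at
      \<open>y = 0\<close>, where division by zero gives 0 and \<open>tpow k 0 = 0\<close> because
      \<open>k > 0\<close>.\<close>
    have "(\<lambda>y. (tpow (Suc k) y - tpow (Suc k) 0) / (y - 0)) = tpow k"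
      using 3 by (auto simp: tpow_def fun_eq_iff)
    moreover have "isCont (tpow k) 0"
    proof -
      obtain m where m: "k = Suc m" using 3 gr0_conv_Suc by blast
      have "continuous_on UNIV (\<lambda>x. tpow (Suc m) x)" by (intro continuous_intros)
      then show ?thesis by (simp add: m continuous_on_eq_continuous_at)
    qed
    ultimately show ?thesis
      using 3 by (simp add: has_field_derivative_iff isCont_def tpow_def[of k 0] zero_power)
  qed
qed

lemma has_integral_tpow_affine:
  fixes c d :: real
  assumes "d \<noteq> 0" "0 \<le> L"
  shows "((\<lambda>y. tpow k (c + d * y)) has_integral
    (tpow (Suc k) (c + d * L) - tpow (Suc k) c) / (Suc k * d)) {0..L}"
proof -
  have "((\<lambda>y. tpow k (c + d * y)) has_integral
    tpow (Suc k) (c + d * L) / (Suc k * d) - tpow (Suc k) (c + d * 0) / (Suc k * d)) {0..L}"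
  \<comment> \<open>The exceptional set is the zero of the affine function, where the antiderivative
    has a kink if \<open>k = 0\<close>.\<close>
  proof (rule fundamental_theorem_of_calculus_interior_strong[where S = "{- c / d}"])
    show "continuous_on {0..L} (\<lambda>y. tpow (Suc k) (c + d * y) / (Suc k * d))"
      using assms by (intro continuous_intros) auto
  next
    fix y assume "y \<in> {0<..<L} - {- c / d}"
    then have "c + d * y \<noteq> 0" using assms by (auto simp: field_simps)
    then have "((\<lambda>y. tpow (Suc k) (c + d * y)) has_real_derivative
      (Suc k * tpow k (c + d * y)) * d) (at y)"
      by (intro DERIV_chain2[OF has_real_derivative_tpow]) (auto intro!: derivative_eq_intros)
    then have "((\<lambda>y. tpow (Suc k) (c + d * y) / (Suc k * d)) has_real_derivative
      ((Suc k * tpow k (c + d * y)) * d) / (Suc k * d)) (at y)"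
      by (rule DERIV_cdivide)
    then show "((\<lambda>y. tpow (Suc k) (c + d * y) / (Suc k * d)) has_vector_derivative
      tpow k (c + d * y)) (at y)"
      using assms by (simp add: has_real_derivative_iff_has_vector_derivative del: of_nat_Suc)
  qed (use assms in auto)
  then show ?thesis by (simp add: diff_divide_distrib)
qed

section \<open>Integrals over triangles and over the diamond
  \<open>\<bar>x\<bar> + \<bar>y\<bar> \<le> r\<close>\<close>

text \<open>The integral of the second derivative of a function along an affine map on a triangle is a second
  divided difference at the three vertex values.\<close>
definition tri :: "nat \<Rightarrow> real \<Rightarrow> real \<Rightarrow> real \<Rightarrow> real \<Rightarrow> real \<Rightarrow> real"
  where "tri k r \<theta> w0 w1 w2 =
    (tpow (k + 2) (r * w0 - \<theta>) / ((w0 - w1) * (w0 - w2))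
   + tpow (k + 2) (r * w1 - \<theta>) / ((w1 - w0) * (w1 - w2))
   + tpow (k + 2) (r * w2 - \<theta>) / ((w2 - w0) * (w2 - w1))) / ((k + 1) * (k + 2))"

text \<open>The affine function takes the values \<open>r * w0 - \<theta>\<close>,
  \<open>r * w1 - \<theta>\<close>, \<open>r * w2 - \<theta>\<close> at the vertices (0, 0), (r, 0),
  (0, r); integrating in y and then in x raises the exponent twice. The sign is recorded as well
  because \<open>ennreal\<close> sends negative numbers to 0.\<close>

lemma nn_integral_triangle:
  fixes r \<theta> w0 w1 w2 :: real
  assumes r: "0 \<le> r" and w: "w0 \<noteq> w1" "w0 \<noteq> w2" "w1 \<noteq> w2"
  shows "(\<integral>\<^sup>+x. \<integral>\<^sup>+y. ennreal (if 0 \<le> x \<and> 0 \<le> y \<and> x + y \<le> r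
      then tpow k (w0 * (r - x - y) + w1 * x + w2 * y - \<theta>) else 0) \<partial>lborel \<partial>lborel)
    = ennreal (tri k r \<theta> w0 w1 w2)"
    and "0 \<le> tri k r \<theta> w0 w1 w2"
proof -
  define f where "f x = (tpow (Suc k) ((r * w2 - \<theta>) + (w1 - w2) * x) -
      tpow (Suc k) ((r * w0 - \<theta>) + (w1 - w0) * x)) / (Suc k * (w2 - w0))" for x
  have inner: "((\<lambda>y. tpow k (w0 * (r - x - y) + w1 * x + w2 * y - \<theta>)) has_integral f x) {0..r - x}"
    if "x \<in> {0..r}" for x
    using has_integral_tpow_affine[of "w2 - w0" "r - x" k "w0 * (r - x) + w1 * x - \<theta>"] that w
    unfolding f_def by (simp add: algebra_simps del: of_nat_Suc)
  have f_nonneg: "0 \<le> f x" if "x \<in> {0..r}" for x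
    by (rule has_integral_nonneg[OF inner[OF that]]) simp
  have outer: "(f has_integral tri k r \<theta> w0 w1 w2) {0..r}"
  proof -
    have "((\<lambda>x. f x) has_integral
       ((tpow (Suc (Suc k)) ((r * w2 - \<theta>) + (w1 - w2) * r) - tpow (Suc (Suc k)) (r * w2 - \<theta>)) /
          (Suc (Suc k) * (w1 - w2)) -
        (tpow (Suc (Suc k)) ((r * w0 - \<theta>) + (w1 - w0) * r) - tpow (Suc (Suc k)) (r * w0 - \<theta>)) /
          (Suc (Suc k) * (w1 - w0))) / (Suc k * (w2 - w0))) {0..r}"
      unfolding f_def using w r
      by (intro has_integral_divide has_integral_diff has_integral_tpow_affine) auto
    moreover have "(r * w2 - \<theta>) + (w1 - w2) * r = r * w1 - \<theta>"
      "(r * w0 - \<theta>) + (w1 - w0) * r = r * w1 - \<theta>" by (auto simp: algebra_simps)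
    moreover have "((p1 - p2) / (Suc (Suc k) * (w1 - w2)) - (p1 - p0) / (Suc (Suc k) * (w1 - w0))) /
        (Suc k * (w2 - w0))
      = (p0 / ((w0 - w1) * (w0 - w2)) + p1 / ((w1 - w0) * (w1 - w2)) +
         p2 / ((w2 - w0) * (w2 - w1))) / ((k + 1) * (k + 2))" for p0 p1 p2 :: real
    proof -
      \<comment> \<open>In terms of the gaps \<open>u\<close> and \<open>v\<close> all denominators
        are products of nonzero factors, so fractions can be cleared.\<close>
      define u where "u = w1 - w0"
      define v where "v = w2 - w1"
      define m where "m = real (Suc k)"
      define n where "n = real (Suc (Suc k))"
      have nz: "u \<noteq> 0" "v \<noteq> 0" "u + v \<noteq> 0" "m \<noteq> 0" "n \<noteq> 0"
        using w by (auto simp: u_def v_def m_def n_def)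
      have e: "w1 - w2 = - v" "w1 - w0 = u" "w2 - w0 = u + v" "w0 - w1 = - u" "w0 - w2 = - (u + v)"
        "w2 - w1 = v" "real ((k + 1) * (k + 2)) = m * n"
        by (auto simp: u_def v_def m_def n_def algebra_simps)
      have "((p1 - p2) / (n * (- v)) - (p1 - p0) / (n * u)) / (m * (u + v))
        = (p0 / ((- u) * (- (u + v))) + p1 / (u * (- v)) + p2 / ((u + v) * v)) / (m * n)"
        using nz by (simp add: divide_simps) (simp add: algebra_simps)
      then show ?thesis unfolding e m_def n_def by simp
    qed
    ultimately show ?thesis by (simp add: tri_def add.commute del: of_nat_Suc)
  qed
  have "(\<integral>\<^sup>+y. ennreal (if 0 \<le> x \<and> 0 \<le> y \<and> x + y \<le> r
      then tpow k (w0 * (r - x - y) + w1 * x + w2 * y - \<theta>) else 0) \<partial>lborel)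
    = ennreal (indicator {0..r} x * f x)" (is "?l x = _") for x
  proof (cases "x \<in> {0..r}")
    case True
    have "?l x = (\<integral>\<^sup>+y. ennreal (indicator {0..r - x} y *
        tpow k (w0 * (r - x - y) + w1 * x + w2 * y - \<theta>)) \<partial>lborel)"
      using True by (intro nn_integral_cong) (auto simp: indicator_def)
    then show ?thesis
      using nn_integral_has_integral_lebesgue[OF _ inner[OF True]] True by simp
  next
    case False
    then show ?thesis by (auto simp: indicator_def intro!: nn_integral_0_iff_AE[THEN iffD2])
  qed
  then show "(\<integral>\<^sup>+x. ?l x \<partial>lborel) = ennreal (tri k r \<theta> w0 w1 w2)"
    using nn_integral_has_integral_lebesgue[OF f_nonneg outer] by simp
  show "0 \<le> tri k r \<theta> w0 w1 w2"
    by (rule has_integral_nonneg[OF outer f_nonneg])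
qed

text \<open>The negative half-line is folded onto the positive one. The point 0 is counted twice,
  which is harmless for a null set.\<close>

lemma nn_integral_reflect:
  fixes f :: "real \<Rightarrow> ennreal"
  assumes f[measurable]: "f \<in> borel_measurable borel"
  shows "(\<integral>\<^sup>+x. f x \<partial>lborel) = (\<integral>\<^sup>+x. (if 0 \<le> x then f x + f (- x) else 0) \<partial>lborel)"
proof -
  have "(\<integral>\<^sup>+x. f x \<partial>lborel) = (\<integral>\<^sup>+x. f x * indicator {0..} x + f x * indicator {..<0} x \<partial>lborel)"
    by (intro nn_integral_cong) (auto simp: indicator_def)
  also have "\<dots> = (\<integral>\<^sup>+x. f x * indicator {0..} x \<partial>lborel) + (\<integral>\<^sup>+x. f x * indicator {..<0} x \<partial>lborel)"
    by (rule nn_integral_add) auto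
  also have "(\<integral>\<^sup>+x. f x * indicator {..<0} x \<partial>lborel) = (\<integral>\<^sup>+x. f (- x) * indicator {..<0} (- x) \<partial>lborel)"
    using nn_integral_real_affine[of "\<lambda>x. f x * indicator {..<0} x" "-1" 0] by simp
  also have "\<dots> = (\<integral>\<^sup>+x. f (- x) * indicator {0..} x \<partial>lborel)"
    by (intro nn_integral_cong_AE eventually_mono[OF AE_lborel_singleton[of 0]])
      (auto simp: indicator_def)
  also have "(\<integral>\<^sup>+x. f x * indicator {0..} x \<partial>lborel) + \<dots> =
      (\<integral>\<^sup>+x. f x * indicator {0..} x + f (- x) * indicator {0..} x \<partial>lborel)"
    by (rule nn_integral_add[symmetric]) auto
  also have "\<dots> = (\<integral>\<^sup>+x. (if 0 \<le> x then f x + f (- x) else 0) \<partial>lborel)"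
    by (intro nn_integral_cong) (auto simp: indicator_def)
  finally show ?thesis .
qed

lemma nn_integral_quadrants:
  fixes f :: "real \<times> real \<Rightarrow> ennreal"
  assumes [measurable]: "f \<in> borel_measurable (borel \<Otimes>\<^sub>M borel)"
  shows "(\<integral>\<^sup>+x. \<integral>\<^sup>+y. f (x, y) \<partial>lborel \<partial>lborel) =
    (\<integral>\<^sup>+x. \<integral>\<^sup>+y. (if 0 \<le> x \<and> 0 \<le> y then f (x, y) else 0) \<partial>lborel \<partial>lborel) +
    (\<integral>\<^sup>+x. \<integral>\<^sup>+y. (if 0 \<le> x \<and> 0 \<le> y then f (x, - y) else 0) \<partial>lborel \<partial>lborel) +
    (\<integral>\<^sup>+x. \<integral>\<^sup>+y. (if 0 \<le> x \<and> 0 \<le> y then f (- x, y) else 0) \<partial>lborel \<partial>lborel) +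
    (\<integral>\<^sup>+x. \<integral>\<^sup>+y. (if 0 \<le> x \<and> 0 \<le> y then f (- x, - y) else 0) \<partial>lborel \<partial>lborel)"
proof -
  have "(\<integral>\<^sup>+x. \<integral>\<^sup>+y. f (x, y) \<partial>lborel \<partial>lborel) =
      (\<integral>\<^sup>+x. (if 0 \<le> x then (\<integral>\<^sup>+y. f (x, y) \<partial>lborel) + (\<integral>\<^sup>+y. f (- x, y) \<partial>lborel) else 0) \<partial>lborel)"
    by (rule nn_integral_reflect) measurable
  also have "\<dots> = (\<integral>\<^sup>+x.
      (\<integral>\<^sup>+y. (if 0 \<le> x \<and> 0 \<le> y then f (x, y) else 0) \<partial>lborel) +
      (\<integral>\<^sup>+y. (if 0 \<le> x \<and> 0 \<le> y then f (x, - y) else 0) \<partial>lborel) +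
      (\<integral>\<^sup>+y. (if 0 \<le> x \<and> 0 \<le> y then f (- x, y) else 0) \<partial>lborel) +
      (\<integral>\<^sup>+y. (if 0 \<le> x \<and> 0 \<le> y then f (- x, - y) else 0) \<partial>lborel) \<partial>lborel)"
  proof (rule nn_integral_cong)
    fix x :: real
    have "(\<integral>\<^sup>+y. f (z, y) \<partial>lborel) = (\<integral>\<^sup>+y. (if 0 \<le> y then f (z, y) else 0) \<partial>lborel) +
      (\<integral>\<^sup>+y. (if 0 \<le> y then f (z, - y) else 0) \<partial>lborel)" for z
      by (subst nn_integral_reflect, measurable, subst nn_integral_add[symmetric])
        (auto intro!: nn_integral_cong)
    then show "(if 0 \<le> x then (\<integral>\<^sup>+y. f (x, y) \<partial>lborel) + (\<integral>\<^sup>+y. f (- x, y) \<partial>lborel) else 0) =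
      (\<integral>\<^sup>+y. (if 0 \<le> x \<and> 0 \<le> y then f (x, y) else 0) \<partial>lborel) +
      (\<integral>\<^sup>+y. (if 0 \<le> x \<and> 0 \<le> y then f (x, - y) else 0) \<partial>lborel) +
      (\<integral>\<^sup>+y. (if 0 \<le> x \<and> 0 \<le> y then f (- x, y) else 0) \<partial>lborel) +
      (\<integral>\<^sup>+y. (if 0 \<le> x \<and> 0 \<le> y then f (- x, - y) else 0) \<partial>lborel)"
      by (auto simp: ac_simps)
  qed
  finally show ?thesis
    by (simp add: nn_integral_add)
qed

text \<open>On each quadrant the integrand is affine, and folding onto the first quadrant only
  changes the signs of \<open>p\<close> and \<open>q\<close>. The squares are assumed distinct so
  that the vertex values differ for every choice of signs.\<close>

lemma nn_integral_diamond:
  fixes r \<theta> c p q :: real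
  assumes r: "0 \<le> r" and w: "c\<^sup>2 \<noteq> p\<^sup>2" "c\<^sup>2 \<noteq> q\<^sup>2" "p\<^sup>2 \<noteq> q\<^sup>2"
  shows "(\<integral>\<^sup>+x. \<integral>\<^sup>+y. ennreal (if \<bar>x\<bar> + \<bar>y\<bar> \<le> r
      then tpow k (c * (r - \<bar>x\<bar> - \<bar>y\<bar>) + p * x + q * y - \<theta>) else 0) \<partial>lborel \<partial>lborel)
    = ennreal (tri k r \<theta> c p q + tri k r \<theta> c p (- q) + tri k r \<theta> c (- p) q + tri k r \<theta> c (- p) (- q))"
proof -
  have *: "(\<integral>\<^sup>+x. \<integral>\<^sup>+y. (if 0 \<le> x \<and> 0 \<le> y then ennreal (if x + y \<le> r
      then tpow k (c * (r - x - y) + p' * x + q' * y - \<theta>) else 0) else 0) \<partial>lborel \<partial>lborel)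
    = ennreal (tri k r \<theta> c p' q')" "0 \<le> tri k r \<theta> c p' q'"
    if "p' = p \<or> p' = - p" "q' = q \<or> q' = - q" for p' q'
  proof -
    have d: "c \<noteq> p'" "c \<noteq> q'" "p' \<noteq> q'" using w that by auto
    show "(\<integral>\<^sup>+x. \<integral>\<^sup>+y. (if 0 \<le> x \<and> 0 \<le> y then ennreal (if x + y \<le> r
      then tpow k (c * (r - x - y) + p' * x + q' * y - \<theta>) else 0) else 0) \<partial>lborel \<partial>lborel)
    = ennreal (tri k r \<theta> c p' q')"
      unfolding nn_integral_triangle(1)[OF r d, symmetric] by (intro nn_integral_cong) auto
    show "0 \<le> tri k r \<theta> c p' q'" by (rule nn_integral_triangle(2)[OF r d])
  qed
  define f where "f = (\<lambda>(x, y). ennreal (if \<bar>x\<bar> + \<bar>y\<bar> \<le> r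
      then tpow k (c * (r - \<bar>x\<bar> - \<bar>y\<bar>) + p * x + q * y - \<theta>) else 0))"
  have [measurable]: "f \<in> borel_measurable (borel \<Otimes>\<^sub>M borel)"
    unfolding f_def by measurable
  have "(\<integral>\<^sup>+x. \<integral>\<^sup>+y. (if 0 \<le> x \<and> 0 \<le> y then f (s * x, t * y) else 0) \<partial>lborel \<partial>lborel)
    = ennreal (tri k r \<theta> c (s * p) (t * q))" if "\<bar>s\<bar> = 1" "\<bar>t\<bar> = 1" for s t
  proof -
    have "s = 1 \<or> s = - 1" "t = 1 \<or> t = - 1" using that by linarith+
    then have "s * p = p \<or> s * p = - p" "t * q = q \<or> t * q = - q" by auto
    from *(1)[OF this] show ?thesis
      unfolding f_def
      by (rule trans[rotated]) (intro nn_integral_cong, auto simp: abs_mult that ac_simps)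
  qed
  note quadrants = this[of 1 1, unfolded mult_1_left mult_minus1] this[of 1 "-1", unfolded mult_1_left mult_minus1]
    this[of "-1" 1, unfolded mult_1_left mult_minus1] this[of "-1" "-1", unfolded mult_minus1]
  have "(\<integral>\<^sup>+x. \<integral>\<^sup>+y. f (x, y) \<partial>lborel \<partial>lborel) = ennreal (tri k r \<theta> c p q) + ennreal (tri k r \<theta> c p (- q))
      + ennreal (tri k r \<theta> c (- p) q) + ennreal (tri k r \<theta> c (- p) (- q))"
    by (simp add: nn_integral_quadrants quadrants)
  then show ?thesis
    by (simp only: f_def prod.case ennreal_plus[symmetric] add_nonneg_nonneg *(2) simp_thms)
qed

section \<open>Coordinates and iterated integrals in four dimensions\<close>

definition vec4 :: "real \<Rightarrow> real \<Rightarrow> real \<Rightarrow> real \<Rightarrow> real ^ 4"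
  where "vec4 x0 x1 x2 x3 = (\<chi> i. if i = 0 then x0 else if i = 1 then x1 else if i = 2 then x2 else x3)"

lemma vec4_nth [simp]:
  "vec4 x0 x1 x2 x3 $ 0 = x0" "vec4 x0 x1 x2 x3 $ 1 = x1"
  "vec4 x0 x1 x2 x3 $ 2 = x2" "vec4 x0 x1 x2 x3 $ 3 = x3"
  by (simp_all add: vec4_def)

lemma UNIV_4': "(UNIV :: 4 set) = {0, 1, 2, 3}"
  using UNIV_4 by auto

lemma forall_4': "(\<forall>i::4. P i) \<longleftrightarrow> P 0 \<and> P 1 \<and> P 2 \<and> P 3"
  using UNIV_4' by (metis UNIV_I empty_iff insert_iff)

lemma sum_4': "(\<Sum>i\<in>(UNIV :: 4 set). f i) = f 0 + f 1 + f 2 + f 3"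
  for f :: "4 \<Rightarrow> 'a::comm_monoid_add"
  unfolding UNIV_4' by (simp add: ac_simps)

lemma prod_4': "(\<Prod>i\<in>(UNIV :: 4 set). f i) = f 0 * f 1 * f 2 * f 3"
  for f :: "4 \<Rightarrow> 'a::comm_monoid_mult"
  unfolding UNIV_4' by (simp add: ac_simps)

lemma borel_measurable_vec4 [measurable]:
  "(\<lambda>(x2, x3, x0, x1). vec4 x0 x1 x2 x3) \<in> borel_measurable borel"
proof -
  have "continuous_on UNIV (\<lambda>(x2, x3, x0, x1). vec4 x0 x1 x2 x3)"
    unfolding vec4_def case_prod_beta
  proof (rule continuous_on_vec_lambda)
    fix i :: 4
    show "continuous_on UNIV (\<lambda>p. if i = 0 then fst (snd (snd p)) else if i = 1 then snd (snd (snd p))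
        else if i = 2 then fst p else fst (snd p :: real \<times> real \<times> real))"
      by (cases "i = 0"; cases "i = 1"; cases "i = 2") (auto intro!: continuous_intros)
  qed
  then show ?thesis by (rule borel_measurable_continuous_onI)
qed

text \<open>Both measures give a box the product of its side lengths. The tuple starts with
  \<open>x2\<close> and \<open>x3\<close> so that Fubini integrates over \<open>(x0, x1)\<close>
  innermost.\<close>

lemma lborel_vec4: "(lborel :: (real ^ 4) measure) =
    distr lborel borel (\<lambda>(x2, x3, x0, x1). vec4 x0 x1 x2 x3)"
proof (rule lborel_eqI)
  fix l u :: "real ^ 4"
  assume lu: "\<And>b. b \<in> Basis \<Longrightarrow> l \<bullet> b \<le> u \<bullet> b"
  have le: "l $ i \<le> u $ i" for i
    using lu[of "axis i 1"] by (simp add: inner_axis)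
  have "(\<lambda>(x2, x3, x0, x1). vec4 x0 x1 x2 x3) -` box l u =
      {l $ 2<..<u $ 2} \<times> {l $ 3<..<u $ 3} \<times> {l $ 0<..<u $ 0} \<times> {l $ 1<..<u $ 1}"
    by (auto simp: mem_box_cart forall_4')
  then have "emeasure (distr lborel borel (\<lambda>(x2, x3, x0, x1). vec4 x0 x1 x2 x3)) (box l u) =
      emeasure lborel ({l $ 2<..<u $ 2} \<times> {l $ 3<..<u $ 3} \<times> {l $ 0<..<u $ 0} \<times> {l $ 1<..<u $ 1})"
    by (subst emeasure_distr) auto
  also have "\<dots> = ennreal ((u - l) $ 0 * (u - l) $ 1 * (u - l) $ 2 * (u - l) $ 3)"
    unfolding lborel_prod[symmetric]
    by (simp add: lborel.emeasure_pair_measure_Times sigma_finite_measure.emeasure_pair_measure_Times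
        sigma_finite_lborel sigma_finite_pair_measure le ennreal_mult[symmetric] ac_simps)
  also have "(u - l) $ 0 * (u - l) $ 1 * (u - l) $ 2 * (u - l) $ 3 = (\<Prod>i\<in>UNIV. (u - l) $ i)"
    by (simp add: prod_4')
  also have "\<dots> = (\<Prod>b\<in>Basis. (u - l) \<bullet> b)"
  proof -
    have Basis: "(Basis :: (real ^ 4) set) = (\<lambda>i. axis i 1) ` UNIV"
      by (auto simp: Basis_vec_def)
    have inj: "inj (\<lambda>i::4. axis i (1::real))"
      by (auto simp: inj_on_def axis_eq_axis)
    show ?thesis
      unfolding Basis prod.reindex[OF inj] by (simp add: inner_axis)
  qed
  finally show "emeasure (distr lborel borel (\<lambda>(x2, x3, x0, x1). vec4 x0 x1 x2 x3)) (box l u) =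
      ennreal (\<Prod>b\<in>Basis. (u - l) \<bullet> b)" .
qed simp

lemma emeasure_lborel_vec4:
  assumes [measurable]: "S \<in> sets borel"
  shows "emeasure lborel S =
    (\<integral>\<^sup>+x2. \<integral>\<^sup>+x3. \<integral>\<^sup>+x0. \<integral>\<^sup>+x1. indicator S (vec4 x0 x1 x2 x3) \<partial>lborel \<partial>lborel \<partial>lborel \<partial>lborel)"
proof -
  let ?T = "\<lambda>(x2, x3, x0, x1). vec4 x0 x1 x2 x3"
  have m: "(\<lambda>p. indicator S (?T p) :: ennreal) \<in> borel_measurable (lborel \<Otimes>\<^sub>M (lborel \<Otimes>\<^sub>M (lborel \<Otimes>\<^sub>M lborel)))"
    unfolding lborel_prod by measurable
  have m3: "(\<lambda>p. indicator S (?T (a, p)) :: ennreal) \<in> borel_measurable (lborel \<Otimes>\<^sub>M (lborel \<Otimes>\<^sub>M lborel))" for a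
    by (rule measurable_compose[OF measurable_Pair1' m]) simp
  have m2: "(\<lambda>p. indicator S (?T (a, b, p)) :: ennreal) \<in> borel_measurable (lborel \<Otimes>\<^sub>M lborel)" for a b
    by (rule measurable_compose[OF measurable_Pair1' m3]) simp
  have "emeasure lborel S = (\<integral>\<^sup>+x. indicator S x \<partial>distr lborel borel ?T)"
    by (subst lborel_vec4) (simp add: assms)
  also have "\<dots> = (\<integral>\<^sup>+p. indicator S (?T p) \<partial>lborel)"
    by (rule nn_integral_distr) auto
  also have "\<dots> = (\<integral>\<^sup>+p. indicator S (?T p) \<partial>(lborel \<Otimes>\<^sub>M (lborel \<Otimes>\<^sub>M (lborel \<Otimes>\<^sub>M lborel))))"
    by (simp add: lborel_prod)
  also have "\<dots> = (\<integral>\<^sup>+x2. \<integral>\<^sup>+q. indicator S (?T (x2, q)) \<partial>(lborel \<Otimes>\<^sub>M (lborel \<Otimes>\<^sub>M lborel)) \<partial>lborel)"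
    by (rule sigma_finite_measure.nn_integral_fst[symmetric, OF _ m])
      (simp add: lborel_prod sigma_finite_lborel)
  also have "\<dots> = (\<integral>\<^sup>+x2. \<integral>\<^sup>+x3. \<integral>\<^sup>+q. indicator S (?T (x2, x3, q)) \<partial>(lborel \<Otimes>\<^sub>M lborel) \<partial>lborel \<partial>lborel)"
    by (intro nn_integral_cong sigma_finite_measure.nn_integral_fst[symmetric, OF _ m3])
      (simp add: lborel_prod sigma_finite_lborel)
  also have "\<dots> = (\<integral>\<^sup>+x2. \<integral>\<^sup>+x3. \<integral>\<^sup>+x0. \<integral>\<^sup>+x1. indicator S (?T (x2, x3, x0, x1)) \<partial>lborel \<partial>lborel \<partial>lborel \<partial>lborel)"
    by (intro nn_integral_cong lborel.nn_integral_fst[symmetric, OF m2])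
  finally show ?thesis by simp
qed

section \<open>The sum over sign patterns as a divided difference in the squares\<close>

text \<open>The contribution of the vertex \<open>w\<close> to \<open>tri 2 2 1\<close>, up to the
  factor 1 / 12.\<close>

definition tterm :: "real \<Rightarrow> real \<Rightarrow> real \<Rightarrow> real"
  where "tterm w x y = tpow 4 (2 * w - 1) / ((w - x) * (w - y))"

text \<open>This is \<open>tpow 4 (2 * \<bar>w\<bar> - 1)\<close>: the two arguments add up to -2,
  so at most one of them is nonnegative.\<close>

definition tpow4_sym :: "real \<Rightarrow> real"
  where "tpow4_sym w = tpow 4 (2 * w - 1) + tpow 4 (- 2 * w - 1)"

text \<open>Eight sign patterns: four quadrants of the \<open>(x2, x3)\<close> plane, each with the
  slopes \<open>c\<close> and \<open>- c\<close>. Exponent 2 is the one left by the area of a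
  slice.\<close>

definition oct :: "real \<Rightarrow> real \<Rightarrow> real \<Rightarrow> real"
  where "oct c p q = tri 2 2 1 c p q + tri 2 2 1 c p (- q) + tri 2 2 1 c (- p) q + tri 2 2 1 c (- p) (- q)
    + (tri 2 2 1 (- c) p q + tri 2 2 1 (- c) p (- q) + tri 2 2 1 (- c) (- p) q + tri 2 2 1 (- c) (- p) (- q))"

text \<open>Regroup the terms by vertex. Over the signs of another node \<open>y\<close>,
  \<open>1 / (x - y) + 1 / (x + y)\<close> equals 2 x over the difference of the squares; doing this
  for both other nodes leaves a second divided difference with the squares as nodes.\<close>

lemma oct_eq:
  assumes "c\<^sup>2 \<noteq> p\<^sup>2" "c\<^sup>2 \<noteq> q\<^sup>2" "p\<^sup>2 \<noteq> q\<^sup>2"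
  shows "oct c p q = (c\<^sup>2 * tpow4_sym c / ((c\<^sup>2 - p\<^sup>2) * (c\<^sup>2 - q\<^sup>2))
    + p\<^sup>2 * tpow4_sym p / ((p\<^sup>2 - c\<^sup>2) * (p\<^sup>2 - q\<^sup>2))
    + q\<^sup>2 * tpow4_sym q / ((q\<^sup>2 - c\<^sup>2) * (q\<^sup>2 - p\<^sup>2))) / 3"
proof -
  have t: "tri 2 2 1 w x y = (tterm w x y + tterm x w y + tterm y w x) / 12" for w x y
    by (simp add: tri_def tterm_def)
  have g: "tterm x y z + tterm x y (- z) + tterm x (- y) z + tterm x (- y) (- z) =
     4 * (x\<^sup>2 * tpow 4 (2 * x - 1) / ((x\<^sup>2 - y\<^sup>2) * (x\<^sup>2 - z\<^sup>2)))" if "x\<^sup>2 \<noteq> y\<^sup>2" "x\<^sup>2 \<noteq> z\<^sup>2" for x y z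
  proof -
    have r: "1 / (x - y) + 1 / (x - - y) = 2 * x / (x\<^sup>2 - y\<^sup>2)" if "x\<^sup>2 \<noteq> y\<^sup>2" for y
    proof -
      have "x - y \<noteq> 0" "x + y \<noteq> 0" using that by (auto simp: power2_eq_square square_eq_iff)
      then show ?thesis by (simp add: field_simps power2_eq_square square_eq_iff)
    qed
    have "tterm x y z + tterm x y (- z) + tterm x (- y) z + tterm x (- y) (- z) =
      tpow 4 (2 * x - 1) * ((1 / (x - y) + 1 / (x - - y)) * (1 / (x - z) + 1 / (x - - z)))"
    proof -
      have e: "tpow 4 (2 * x - 1) / (u * v) = tpow 4 (2 * x - 1) * ((1 / u) * (1 / v))" for u v
        by simp
      have "T * (a * b) + T * (a * d) + T * (c * b) + T * (c * d) = T * ((a + c) * (b + d))"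
        for T a b c d :: real by algebra
      then show ?thesis unfolding tterm_def e .
    qed
    then show ?thesis unfolding r[OF that(1)] r[OF that(2)] by (simp add: power2_eq_square)
  qed
  have s: "tpow4_sym w = tpow 4 (2 * w - 1) + tpow 4 (2 * (- w) - 1)" for w
    by (simp add: tpow4_sym_def)
  have c: "tterm c p q + tterm c p (- q) + tterm c (- p) q + tterm c (- p) (- q)
      + (tterm (- c) p q + tterm (- c) p (- q) + tterm (- c) (- p) q + tterm (- c) (- p) (- q))
      = 4 * (c\<^sup>2 * tpow4_sym c / ((c\<^sup>2 - p\<^sup>2) * (c\<^sup>2 - q\<^sup>2)))"
    and p: "tterm p c q + tterm p c (- q) + tterm p (- c) q + tterm p (- c) (- q)
      + (tterm (- p) c q + tterm (- p) c (- q) + tterm (- p) (- c) q + tterm (- p) (- c) (- q))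
      = 4 * (p\<^sup>2 * tpow4_sym p / ((p\<^sup>2 - c\<^sup>2) * (p\<^sup>2 - q\<^sup>2)))"
    and q: "tterm q c p + tterm q c (- p) + tterm q (- c) p + tterm q (- c) (- p)
      + (tterm (- q) c p + tterm (- q) c (- p) + tterm (- q) (- c) p + tterm (- q) (- c) (- p))
      = 4 * (q\<^sup>2 * tpow4_sym q / ((q\<^sup>2 - c\<^sup>2) * (q\<^sup>2 - p\<^sup>2)))"
    using assms by (simp_all add: g s ring_distribs add_divide_distrib del: minus_mult_right[symmetric])
  show ?thesis
    unfolding oct_def t using c p q by argo
qed

section \<open>The cap, its two-dimensional slices and Fubini\<close>

lemma closed_B: "closed B"
proof -
  have "B = (\<lambda>x. \<bar>x $ 0\<bar> + \<bar>x $ 1\<bar> + \<bar>x $ 2\<bar> + \<bar>x $ 3\<bar>) -` {..2}" by (auto simp: B_def)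
  moreover have "closed \<dots>"
    by (intro closed_vimage closed_atMost continuous_intros)
  ultimately show ?thesis by simp
qed

lemma bounded_B: "bounded B"
proof (rule boundedI)
  fix x assume x: "x \<in> B"
  have "norm x \<le> (\<Sum>i\<in>UNIV. \<bar>x $ i\<bar>)" by (rule norm_le_l1_cart)
  with x show "norm x \<le> 2" by (simp add: sum_4' B_def)
qed

text \<open>The vector \<open>a\<close> need not have norm 1: rescaled normals serve to compare
  caps.\<close>

definition cap :: "real ^ 4 \<Rightarrow> (real ^ 4) set"
  where "cap a = B \<inter> {x. x \<bullet> a \<ge> 1}"

lemma closed_cap: "closed (cap a)"
proof -
  have "closed {x. x \<bullet> a \<ge> 1}"
    using closed_halfspace_ge[of 1 a] by (simp add: inner_commute)
  then show ?thesis unfolding cap_def by (intro closed_Int closed_B)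
qed

lemma bounded_cap: "bounded (cap a)"
  unfolding cap_def by (rule bounded_subset[OF bounded_B]) auto

lemma cap_lmeasurable: "cap a \<in> lmeasurable"
  by (intro lmeasurable_compact) (simp add: compact_eq_bounded_closed closed_cap bounded_cap)

lemma vec4_in_cap: "vec4 x0 x1 x2 x3 \<in> cap a \<longleftrightarrow>
    \<bar>x0\<bar> + \<bar>x1\<bar> \<le> 2 - \<bar>x2\<bar> - \<bar>x3\<bar> \<and> 1 - a $ 2 * x2 - a $ 3 * x3 \<le> a $ 0 * x0 + a $ 1 * x1"
  by (auto simp: cap_def B_def inner_vec_def sum_4' algebra_simps)

text \<open>The diamond integral with \<open>k = 0\<close> and \<open>c = 0\<close>, where
  \<open>tpow 0\<close> is the indicator of the half-plane. The terms of the common vertex at the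
  origin carry the factors \<open>\<plusminus> 1 / (p * q)\<close> and cancel.\<close>

lemma nn_integral_slice:
  fixes r \<theta> p q :: real
  assumes r: "0 \<le> r" and pq: "p \<noteq> 0" "q \<noteq> 0" "p\<^sup>2 \<noteq> q\<^sup>2"
  defines "A \<equiv> (tpow 2 (r * p - \<theta>) + tpow 2 (- r * p - \<theta>)
     - tpow 2 (r * q - \<theta>) - tpow 2 (- r * q - \<theta>)) / (p\<^sup>2 - q\<^sup>2)"
  shows "(\<integral>\<^sup>+x. \<integral>\<^sup>+y. indicator {(x, y). \<bar>x\<bar> + \<bar>y\<bar> \<le> r \<and> \<theta> \<le> p * x + q * y} (x, y) \<partial>lborel \<partial>lborel) = ennreal A"
    and "0 \<le> A"
proof -
  have nz: "p + q \<noteq> 0" "p - q \<noteq> 0" using pq by (auto simp: power2_eq_square square_eq_iff)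
  have "tri 0 r \<theta> 0 p q + tri 0 r \<theta> 0 p (- q) + tri 0 r \<theta> 0 (- p) q + tri 0 r \<theta> 0 (- p) (- q) = A"
  proof -
    have "(t0 / (p * q) + t1 / (p * (p - q)) + t2 / (q * (q - p))) / 2
        + (t0 / (- p * q) + t1 / (p * (p + q)) + t3 / (q * (q + p))) / 2
        + (t0 / (- p * q) + t4 / (p * (p + q)) + t2 / (q * (q + p))) / 2
        + (t0 / (p * q) + t4 / (p * (p - q)) + t3 / (q * (q - p))) / 2
        = (t1 + t4 - t2 - t3) / (p\<^sup>2 - q\<^sup>2)" for t0 t1 t2 t3 t4
    proof -
      have 1: "1 / (p * (p - q)) + 1 / (p * (p + q)) = 2 / (p\<^sup>2 - q\<^sup>2)"
        using pq nz by (simp add: divide_simps) (simp add: algebra_simps power2_eq_square)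
      have 2: "1 / (q * (q - p)) + 1 / (q * (q + p)) = - 2 / (p\<^sup>2 - q\<^sup>2)"
        using pq nz by (simp add: divide_simps) (simp add: algebra_simps power2_eq_square)
      have "(t0 / (p * q) + t1 / (p * (p - q)) + t2 / (q * (q - p))) / 2
        + (t0 / (- p * q) + t1 / (p * (p + q)) + t3 / (q * (q + p))) / 2
        + (t0 / (- p * q) + t4 / (p * (p + q)) + t2 / (q * (q + p))) / 2
        + (t0 / (p * q) + t4 / (p * (p - q)) + t3 / (q * (q - p))) / 2
        = (t1 + t4) / 2 * (1 / (p * (p - q)) + 1 / (p * (p + q)))
        + (t2 + t3) / 2 * (1 / (q * (q - p)) + 1 / (q * (q + p)))"
      proof -
        have "(t0 * e + t1 * \<alpha> + t2 * \<gamma>) / 2 + (- (t0 * e) + t1 * \<beta> + t3 * \<delta>) / 2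
          + (- (t0 * e) + t4 * \<beta> + t2 * \<delta>) / 2 + (t0 * e + t4 * \<alpha> + t3 * \<gamma>) / 2
          = (t1 + t4) / 2 * (\<alpha> + \<beta>) + (t2 + t3) / 2 * (\<gamma> + \<delta>)" for e \<alpha> \<beta> \<gamma> \<delta>
          by (simp add: field_simps)
        from this[of "1 / (p * q)" "1 / (p * (p - q))" "1 / (q * (q - p))" "1 / (p * (p + q))" "1 / (q * (q + p))"]
        show ?thesis by simp
      qed
      then show ?thesis unfolding 1 2 by (simp add: diff_divide_distrib add_divide_distrib)
    qed
    from this[of "tpow 2 (- \<theta>)" "tpow 2 (r * p - \<theta>)" "tpow 2 (r * q - \<theta>)" "tpow 2 (- r * q - \<theta>)"
      "tpow 2 (- r * p - \<theta>)"]
    show ?thesis unfolding A_def tri_def by (simp add: algebra_simps del: add_2_eq_Suc add_2_eq_Suc')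
  qed
  note A = this
  have "(\<integral>\<^sup>+x. \<integral>\<^sup>+y. indicator {(x, y). \<bar>x\<bar> + \<bar>y\<bar> \<le> r \<and> \<theta> \<le> p * x + q * y} (x, y) \<partial>lborel \<partial>lborel) =
    (\<integral>\<^sup>+x. \<integral>\<^sup>+y. ennreal (if \<bar>x\<bar> + \<bar>y\<bar> \<le> r
      then tpow 0 (0 * (r - \<bar>x\<bar> - \<bar>y\<bar>) + p * x + q * y - \<theta>) else 0) \<partial>lborel \<partial>lborel)"
    by (intro nn_integral_cong) (auto simp: tpow_def)
  also have "\<dots> = ennreal A"
    unfolding A[symmetric] using pq by (intro nn_integral_diamond r) auto
  finally show "(\<integral>\<^sup>+x. \<integral>\<^sup>+y. indicator {(x, y). \<bar>x\<bar> + \<bar>y\<bar> \<le> r \<and> \<theta> \<le> p * x + q * y} (x, y) \<partial>lborel \<partial>lborel) = ennreal A" .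
  show "0 \<le> A"
    unfolding A[symmetric] using pq nz by (intro add_nonneg_nonneg nn_integral_triangle(2) r) auto
qed

lemma oct_nonneg:
  assumes "c\<^sup>2 \<noteq> p\<^sup>2" "c\<^sup>2 \<noteq> q\<^sup>2" "p\<^sup>2 \<noteq> q\<^sup>2"
  shows "0 \<le> oct c p q"
  using assms unfolding oct_def by (intro add_nonneg_nonneg nn_integral_triangle(2)) auto

text \<open>The two summands are diamond integrands with \<open>r = 2\<close>,
  \<open>\<theta> = 1\<close> and slopes \<open>c\<close> and \<open>- c\<close>, the two halves of
  \<open>oct\<close>.\<close>

lemma nn_integral_oct:
  fixes c p q :: real
  assumes w: "c\<^sup>2 \<noteq> p\<^sup>2" "c\<^sup>2 \<noteq> q\<^sup>2" "p\<^sup>2 \<noteq> q\<^sup>2"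
  shows "(\<integral>\<^sup>+x. \<integral>\<^sup>+y. ennreal (if \<bar>x\<bar> + \<bar>y\<bar> \<le> 2
      then tpow 2 ((2 - \<bar>x\<bar> - \<bar>y\<bar>) * c - (1 - p * x - q * y)) +
           tpow 2 (- (2 - \<bar>x\<bar> - \<bar>y\<bar>) * c - (1 - p * x - q * y)) else 0) \<partial>lborel \<partial>lborel)
    = ennreal (oct c p q)"
proof -
  define f where "f c = (\<lambda>(x, y). ennreal (if \<bar>x\<bar> + \<bar>y\<bar> \<le> 2
      then tpow 2 (c * (2 - \<bar>x\<bar> - \<bar>y\<bar>) + p * x + q * y - 1) else 0))" for c
  have [measurable]: "f c \<in> borel_measurable (borel \<Otimes>\<^sub>M borel)" for c
    unfolding f_def by measurable
  have f: "(\<integral>\<^sup>+x. \<integral>\<^sup>+y. f c' (x, y) \<partial>lborel \<partial>lborel) = ennreal (tri 2 2 1 c' p q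
      + tri 2 2 1 c' p (- q) + tri 2 2 1 c' (- p) q + tri 2 2 1 c' (- p) (- q))"
    if "c' = c \<or> c' = - c" for c'
    unfolding f_def prod.case using w that by (intro nn_integral_diamond) auto
  have "(\<integral>\<^sup>+x. \<integral>\<^sup>+y. ennreal (if \<bar>x\<bar> + \<bar>y\<bar> \<le> 2
      then tpow 2 ((2 - \<bar>x\<bar> - \<bar>y\<bar>) * c - (1 - p * x - q * y)) +
           tpow 2 (- (2 - \<bar>x\<bar> - \<bar>y\<bar>) * c - (1 - p * x - q * y)) else 0) \<partial>lborel \<partial>lborel)
     = (\<integral>\<^sup>+x. \<integral>\<^sup>+y. f c (x, y) + f (- c) (x, y) \<partial>lborel \<partial>lborel)"
    by (intro nn_integral_cong) (auto simp: f_def algebra_simps)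
  also have "\<dots> = (\<integral>\<^sup>+x. \<integral>\<^sup>+y. f c (x, y) \<partial>lborel \<partial>lborel) + (\<integral>\<^sup>+x. \<integral>\<^sup>+y. f (- c) (x, y) \<partial>lborel \<partial>lborel)"
    by (simp add: nn_integral_add)
  also have "\<dots> = ennreal (oct c p q)"
    unfolding f[OF disjI1[OF refl]] f[OF disjI2[OF refl]] oct_def
    using w by (intro ennreal_plus[symmetric] add_nonneg_nonneg nn_integral_triangle(2)) auto
  finally show ?thesis .
qed

text \<open>Slice areas are integrated over \<open>(x2, x3)\<close>. Their denominator is constant,
  and the two parts of the numerator integrate to \<open>oct\<close>.\<close>

lemma measure_cap_oct:
  fixes a :: "real ^ 4"
  assumes inj: "inj (\<lambda>i. (a $ i)\<^sup>2)" and nz: "a $ 0 \<noteq> 0" "a $ 1 \<noteq> 0"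
  shows "measure lborel (cap a) =
    (oct (a $ 0) (a $ 2) (a $ 3) - oct (a $ 1) (a $ 2) (a $ 3)) / ((a $ 0)\<^sup>2 - (a $ 1)\<^sup>2)"
proof -
  have d: "(a $ i)\<^sup>2 \<noteq> (a $ j)\<^sup>2" if "i \<noteq> j" for i j
    using injD[OF inj, of i j] that by auto
  define P where "P c = (\<lambda>(x, y). if \<bar>x\<bar> + \<bar>y\<bar> \<le> 2
      then tpow 2 ((2 - \<bar>x\<bar> - \<bar>y\<bar>) * c - (1 - a $ 2 * x - a $ 3 * y)) +
           tpow 2 (- (2 - \<bar>x\<bar> - \<bar>y\<bar>) * c - (1 - a $ 2 * x - a $ 3 * y)) else 0)" for c
  have [measurable]: "P c \<in> borel_measurable (borel \<Otimes>\<^sub>M borel)" for c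
    unfolding P_def by measurable
  have P_nonneg: "0 \<le> P c z" for c z
    by (auto simp: P_def split: prod.splits)
  \<comment> \<open>The area of the slice at \<open>z = (x2, x3)\<close>; it vanishes where the
    radius of the slice is negative.\<close>
  define A where "A = (\<lambda>z. (P (a $ 0) z - P (a $ 1) z) / ((a $ 0)\<^sup>2 - (a $ 1)\<^sup>2))"
  have [measurable]: "A \<in> borel_measurable (borel \<Otimes>\<^sub>M borel)"
    unfolding A_def by measurable
  have slice: "(\<integral>\<^sup>+x0. \<integral>\<^sup>+x1. indicator (cap a) (vec4 x0 x1 x2 x3) \<partial>lborel \<partial>lborel) = ennreal (A (x2, x3))"
    "0 \<le> A (x2, x3)" for x2 x3
  proof -
    define r where "r = 2 - \<bar>x2\<bar> - \<bar>x3\<bar>"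
    define \<theta> where "\<theta> = 1 - a $ 2 * x2 - a $ 3 * x3"
    have "(\<integral>\<^sup>+x0. \<integral>\<^sup>+x1. indicator (cap a) (vec4 x0 x1 x2 x3) \<partial>lborel \<partial>lborel) =
      (\<integral>\<^sup>+x. \<integral>\<^sup>+y. indicator {(x, y). \<bar>x\<bar> + \<bar>y\<bar> \<le> r \<and> \<theta> \<le> a $ 0 * x + a $ 1 * y} (x, y) \<partial>lborel \<partial>lborel)"
      unfolding r_def \<theta>_def by (intro nn_integral_cong) (simp add: indicator_def vec4_in_cap)
    moreover have "\<dots> = ennreal (A (x2, x3)) \<and> 0 \<le> A (x2, x3)"
    proof (cases "0 \<le> r")
      case True
      then have "A (x2, x3) = (tpow 2 (r * a $ 0 - \<theta>) + tpow 2 (- r * a $ 0 - \<theta>)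
         - tpow 2 (r * a $ 1 - \<theta>) - tpow 2 (- r * a $ 1 - \<theta>)) / ((a $ 0)\<^sup>2 - (a $ 1)\<^sup>2)"
        by (simp add: A_def P_def r_def \<theta>_def)
      then show ?thesis
        using nn_integral_slice[OF True nz d[of 0 1], of \<theta>] by simp
    next
      case False
      then have "indicator {(x, y). \<bar>x\<bar> + \<bar>y\<bar> \<le> r \<and> \<theta> \<le> a $ 0 * x + a $ 1 * y} (x, y) = (0 :: ennreal)" for x y
        by (auto simp: indicator_def)
      moreover have "A (x2, x3) = 0" using False by (auto simp: A_def P_def r_def)
      ultimately show ?thesis by simp
    qed
    ultimately show "(\<integral>\<^sup>+x0. \<integral>\<^sup>+x1. indicator (cap a) (vec4 x0 x1 x2 x3) \<partial>lborel \<partial>lborel) = ennreal (A (x2, x3))"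
      "0 \<le> A (x2, x3)" by auto
  qed
  define I where "I = emeasure lborel (cap a)"
  have I: "I = (\<integral>\<^sup>+x2. \<integral>\<^sup>+x3. ennreal (A (x2, x3)) \<partial>lborel \<partial>lborel)"
    unfolding I_def by (subst emeasure_lborel_vec4) (auto simp: slice closed_cap borel_closed)
  have K: "(\<integral>\<^sup>+x2. \<integral>\<^sup>+x3. ennreal (P c (x2, x3)) \<partial>lborel \<partial>lborel) = ennreal (oct c (a $ 2) (a $ 3))"
    if "c = a $ 0 \<or> c = a $ 1" for c
    unfolding P_def prod.case using that d by (intro nn_integral_oct) auto
  have K_nonneg: "0 \<le> oct c (a $ 2) (a $ 3)" if "c = a $ 0 \<or> c = a $ 1" for c
    using that d by (intro oct_nonneg) auto
  \<comment> \<open>Subtraction in \<open>ennreal\<close> truncates, so the difference is stated as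
    a sum with a positive factor \<open>m\<close>. The two orders of \<open>c\<close> and
    \<open>c'\<close> cover both signs of the denominator.\<close>
  have key: "measure lborel (cap a) = (oct c (a $ 2) (a $ 3) - oct c' (a $ 2) (a $ 3)) / m"
    if "P c = (\<lambda>z. m * A z + P c' z)" "0 < m" "c = a $ 0 \<or> c = a $ 1" "c' = a $ 0 \<or> c' = a $ 1" for c c' m
  proof -
    have "ennreal (oct c (a $ 2) (a $ 3)) = (\<integral>\<^sup>+x2. \<integral>\<^sup>+x3. ennreal m * ennreal (A (x2, x3)) + ennreal (P c' (x2, x3)) \<partial>lborel \<partial>lborel)"
      unfolding K[OF that(3), symmetric] that(1)
      using that(2) slice(2) P_nonneg by (intro nn_integral_cong) (simp add: ennreal_mult)
    also have "\<dots> = ennreal m * I + ennreal (oct c' (a $ 2) (a $ 3))"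
      unfolding I K[OF that(4), symmetric] by (simp add: nn_integral_add nn_integral_cmult)
    finally have e: "ennreal (oct c (a $ 2) (a $ 3)) = ennreal m * I + ennreal (oct c' (a $ 2) (a $ 3))" .
    \<comment> \<open>An infinite volume would make the right side of \<open>e\<close> infinite,
      while its left side is finite.\<close>
    have "I \<noteq> \<infinity>"
    proof
      assume "I = \<infinity>"
      with e that(2) show False by (simp add: ennreal_mult_top)
    qed
    then obtain v where v: "I = ennreal v" "0 \<le> v" by (cases I) auto
    have "ennreal (oct c (a $ 2) (a $ 3)) = ennreal (m * v + oct c' (a $ 2) (a $ 3))"
      unfolding e using v that K_nonneg by (simp add: ennreal_mult)
    then have "oct c (a $ 2) (a $ 3) = m * v + oct c' (a $ 2) (a $ 3)"
      using K_nonneg that v by (subst (asm) ennreal_inj) auto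
    moreover have "measure lborel (cap a) = v" using v by (simp add: measure_def I_def)
    ultimately show ?thesis using that(2) by (simp add: field_simps)
  qed
  have dd: "(a $ 0)\<^sup>2 \<noteq> (a $ 1)\<^sup>2" by (rule d) simp
  then consider "(a $ 1)\<^sup>2 < (a $ 0)\<^sup>2" | "(a $ 0)\<^sup>2 < (a $ 1)\<^sup>2" by linarith
  then show ?thesis
  proof cases
    case 1
    then have "P (a $ 0) = (\<lambda>z. ((a $ 0)\<^sup>2 - (a $ 1)\<^sup>2) * A z + P (a $ 1) z)"
      by (auto simp: A_def fun_eq_iff)
    from key[OF this] 1 show ?thesis by simp
  next
    case 2
    then have "P (a $ 1) = (\<lambda>z. ((a $ 1)\<^sup>2 - (a $ 0)\<^sup>2) * A z + P (a $ 0) z)"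
      by (auto simp: A_def fun_eq_iff field_simps)
    from key[OF this] 2 have "measure lborel (cap a) = (oct (a $ 1) (a $ 2) (a $ 3) - oct (a $ 0) (a $ 2) (a $ 3)) / ((a $ 1)\<^sup>2 - (a $ 0)\<^sup>2)"
      by simp
    also have "(oct (a $ 1) (a $ 2) (a $ 3) - oct (a $ 0) (a $ 2) (a $ 3)) / ((a $ 1)\<^sup>2 - (a $ 0)\<^sup>2)
      = (oct (a $ 0) (a $ 2) (a $ 3) - oct (a $ 1) (a $ 2) (a $ 3)) / ((a $ 0)\<^sup>2 - (a $ 1)\<^sup>2)"
      using 2 by (simp add: field_simps)
    finally show ?thesis .
  qed
qed

section \<open>The volume as a third divided difference\<close>

text \<open>The Lagrange form of Newton's divided difference. Taking the nodes as a set makes them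
  distinct and the expression symmetric.\<close>

definition divdiff :: "(real \<Rightarrow> real) \<Rightarrow> real set \<Rightarrow> real"
  where "divdiff f S = (\<Sum>x\<in>S. f x / (\<Prod>y\<in>S - {x}. x - y))"

text \<open>The function g of the overview. For negative \<open>b\<close> the root is negative too,
  so the value is 0.\<close>

definition capfun :: "real \<Rightarrow> real"
  where "capfun b = b * tpow 4 (2 * sqrt b - 1)"

lemma capfun_square: "capfun (w\<^sup>2) = w\<^sup>2 * tpow4_sym w"
  by (auto simp: capfun_def tpow4_sym_def tpow_def)

text \<open>Each \<open>oct\<close> is one third of a second divided difference, and the quotient in
  \<open>measure_cap_oct\<close> is the step of Newton's recursion from second to third
  order.\<close>

lemma measure_cap:
  fixes a :: "real ^ 4"
  assumes inj: "inj (\<lambda>i. (a $ i)\<^sup>2)" and nz: "\<And>i. a $ i \<noteq> 0"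
  shows "measure lebesgue (cap a) = divdiff capfun (range (\<lambda>i. (a $ i)\<^sup>2)) / 3"
proof -
  have d: "(a $ i)\<^sup>2 \<noteq> (a $ j)\<^sup>2" if "i \<noteq> j" for i j
    using injD[OF inj, of i j] that by auto
  define b where "b i = (a $ i)\<^sup>2" for i
  define g where "g i = (a $ i)\<^sup>2 * tpow4_sym (a $ i)" for i
  let ?D = "divdiff capfun (range (\<lambda>i. (a $ i)\<^sup>2))"
  \<comment> \<open>Newton's recursion for the nodes \<open>b0, b2, b3\<close> and
    \<open>b1, b2, b3\<close>, multiplied by \<open>b0 - b1\<close>.\<close>
  have alg: "(g0 / ((b0 - b2) * (b0 - b3)) + g2 / ((b2 - b0) * (b2 - b3)) + g3 / ((b3 - b0) * (b3 - b2))) / 3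
    - (g1 / ((b1 - b2) * (b1 - b3)) + g2 / ((b2 - b1) * (b2 - b3)) + g3 / ((b3 - b1) * (b3 - b2))) / 3
    = (b0 - b1) * ((g0 / ((b0 - b1) * ((b0 - b2) * (b0 - b3))) + g1 / ((b1 - b0) * ((b1 - b2) * (b1 - b3)))
      + g2 / ((b2 - b0) * ((b2 - b1) * (b2 - b3))) + g3 / ((b3 - b0) * ((b3 - b1) * (b3 - b2)))) / 3)"
    if "b0 \<noteq> b1" "b0 \<noteq> b2" "b0 \<noteq> b3" "b1 \<noteq> b2" "b1 \<noteq> b3" "b2 \<noteq> b3"
    for b0 b1 b2 b3 g0 g1 g2 g3 :: real
  proof -
    have 0: "(b0 - b1) * (g0 / ((b0 - b1) * X)) = g0 / X" for X using that by simp
    have 1: "(b0 - b1) * (g1 / ((b1 - b0) * X)) = - g1 / X" for X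
      using that by (cases "X = 0") (auto simp: field_simps)
    have 2: "(b0 - b1) * (g / ((b - b0) * ((b - b1) * X))) = g / ((b - b0) * X) - g / ((b - b1) * X)"
      if "b \<noteq> b0" "b \<noteq> b1" for g b X
      using that by (cases "X = 0") (simp_all add: divide_simps, simp add: algebra_simps)
    show ?thesis
      using 2[of b2 g2 "b2 - b3"] 2[of b3 g3 "b3 - b2"] 0[of "(b0 - b2) * (b0 - b3)"]
        1[of "(b1 - b2) * (b1 - b3)"] that by (simp only: distrib_left times_divide_eq_right) argo
  qed
  have "?D = (\<Sum>i\<in>UNIV. capfun ((a $ i)\<^sup>2) / (\<Prod>j\<in>UNIV - {i}. (a $ i)\<^sup>2 - (a $ j)\<^sup>2))"
    unfolding divdiff_def sum.reindex[OF inj]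
  proof (intro sum.cong refl)
    fix i :: 4
    have "(\<lambda>i. (a $ i)\<^sup>2) ` UNIV - {(a $ i)\<^sup>2} = (\<lambda>i. (a $ i)\<^sup>2) ` (UNIV - {i})"
      using inj by (auto simp: inj_def)
    then show "((\<lambda>x. capfun x / (\<Prod>y\<in>range (\<lambda>i. (a $ i)\<^sup>2) - {x}. x - y)) \<circ> (\<lambda>i. (a $ i)\<^sup>2)) i =
      capfun ((a $ i)\<^sup>2) / (\<Prod>j\<in>UNIV - {i}. (a $ i)\<^sup>2 - (a $ j)\<^sup>2)"
      using inj by (simp add: prod.reindex inj_on_subset)
  qed
  moreover have "UNIV - {0::4} = {1, 2, 3}" "UNIV - {1::4} = {0, 2, 3}" "UNIV - {2::4} = {0, 1, 3}"
    "UNIV - {3::4} = {0, 1, 2}"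
    unfolding UNIV_4' by auto
  ultimately have D: "?D = g 0 / ((b 0 - b 1) * ((b 0 - b 2) * (b 0 - b 3)))
      + g 1 / ((b 1 - b 0) * ((b 1 - b 2) * (b 1 - b 3)))
      + g 2 / ((b 2 - b 0) * ((b 2 - b 1) * (b 2 - b 3)))
      + g 3 / ((b 3 - b 0) * ((b 3 - b 1) * (b 3 - b 2)))"
    by (simp add: sum_4' capfun_square g_def b_def)
  have "oct (a $ 0) (a $ 2) (a $ 3) = (g 0 / ((b 0 - b 2) * (b 0 - b 3))
      + g 2 / ((b 2 - b 0) * (b 2 - b 3)) + g 3 / ((b 3 - b 0) * (b 3 - b 2))) / 3"
    unfolding g_def b_def by (intro oct_eq d) auto
  moreover have "oct (a $ 1) (a $ 2) (a $ 3) = (g 1 / ((b 1 - b 2) * (b 1 - b 3))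
      + g 2 / ((b 2 - b 1) * (b 2 - b 3)) + g 3 / ((b 3 - b 1) * (b 3 - b 2))) / 3"
    unfolding g_def b_def by (intro oct_eq d) auto
  ultimately have "oct (a $ 0) (a $ 2) (a $ 3) - oct (a $ 1) (a $ 2) (a $ 3) = (b 0 - b 1) * (?D / 3)"
    unfolding D by (simp only:, intro alg) (use d in \<open>auto simp: b_def\<close>)
  moreover have "b 0 - b 1 \<noteq> 0"
    using d[of 0 1] by (simp add: b_def)
  moreover have "measure lebesgue (cap a) = measure lborel (cap a)"
    by (simp add: measure_completion closed_cap borel_closed)
  ultimately show ?thesis
    using measure_cap_oct[OF inj nz nz] by (simp add: b_def)
qed

lemma capfun_eq_0: "b \<le> 1 / 4 \<Longrightarrow> capfun b = 0"
proof -
  assume "b \<le> 1 / 4"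
  then have "sqrt b \<le> sqrt ((1 / 2)\<^sup>2)" by (intro real_sqrt_le_mono) (simp add: power2_eq_square)
  then have "2 * sqrt b - 1 \<le> 0" by simp
  then show ?thesis by (simp add: capfun_def tpow_def)
qed

section \<open>Third divided differences and their mean value theorem\<close>

lemma divdiff_cong: "(\<And>x. x \<in> S \<Longrightarrow> f x = g x) \<Longrightarrow> divdiff f S = divdiff g S"
  unfolding divdiff_def by (intro sum.cong) auto

lemma divdiff_diff: "divdiff (\<lambda>x. f x - g x) S = divdiff f S - divdiff g S"
  unfolding divdiff_def by (simp add: sum_subtractf diff_divide_distrib)

lemma card_4_sorted:
  fixes S :: "real set"
  assumes "card S = 4"
  obtains p q r s where "S = {p, q, r, s}" "p < q" "q < r" "r < s"
proof -
  have "finite S" using assms by (intro card_ge_0_finite) simp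
  define xs where "xs = sorted_list_of_set S"
  have "length xs = 4" "sorted_wrt (<) xs" "set xs = S"
    using assms \<open>finite S\<close> by (auto simp: xs_def)
  then obtain p q r s where "xs = [p, q, r, s]"
    by (auto simp: numeral_eq_Suc length_Suc_conv)
  with \<open>sorted_wrt (<) xs\<close> \<open>set xs = S\<close> that show ?thesis by auto
qed

text \<open>Multiplying by the Vandermonde product clears the denominators; the right side is the
  expansion of the determinant with rows 1, x, x^2, f along the row of \<open>f\<close>.\<close>

lemma divdiff_4:
  assumes "p < q" "q < r" "r < (s::real)"
  shows "divdiff f {p, q, r, s} * ((q - p) * (r - p) * (s - p) * (r - q) * (s - q) * (s - r)) =
    - f p * ((r - q) * (s - q) * (s - r)) + f q * ((r - p) * (s - p) * (s - r))
    - f r * ((q - p) * (s - p) * (s - q)) + f s * ((q - p) * (r - p) * (r - q))"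
proof -
  have "{p, q, r, s} - {p} = {q, r, s}" "{p, q, r, s} - {q} = {p, r, s}"
    "{p, q, r, s} - {r} = {p, q, s}" "{p, q, r, s} - {s} = {p, q, r}"
    using assms by auto
  then have dd: "divdiff f {p, q, r, s} = f p / ((p - q) * ((p - r) * (p - s)))
    + (f q / ((q - p) * ((q - r) * (q - s))) + (f r / ((r - p) * ((r - q) * (r - s)))
    + f s / ((s - p) * ((s - q) * (s - r)))))"
    using assms by (simp add: divdiff_def)
  let ?V = "(q - p) * (r - p) * (s - p) * (r - q) * (s - q) * (s - r)"
  have t: "F / X * V = F * W" if "V = X * W" "X \<noteq> 0" for F X V W :: real
    using that by simp
  have "f p / ((p - q) * ((p - r) * (p - s))) * ?V = f p * (- ((r - q) * (s - q) * (s - r)))"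
    by (rule t, algebra) (use assms in auto)
  moreover have "f q / ((q - p) * ((q - r) * (q - s))) * ?V = f q * ((r - p) * (s - p) * (s - r))"
    by (rule t, algebra) (use assms in auto)
  moreover have "f r / ((r - p) * ((r - q) * (r - s))) * ?V = f r * (- ((q - p) * (s - p) * (s - q)))"
    by (rule t, algebra) (use assms in auto)
  moreover have "f s / ((s - p) * ((s - q) * (s - r))) * ?V = f s * ((q - p) * (r - p) * (r - q))"
    by (rule t, algebra) (use assms in auto)
  ultimately show ?thesis
    unfolding dd by (simp only: distrib_right[of _ _ ?V] mult_minus_right mult_minus_left add_uminus_conv_diff add.assoc)
qed

text \<open>The third divided difference of x^n is the complete homogeneous symmetric polynomial of
  degree n - 3 in the nodes, and 0 for n < 3. In degree 2 it is half the sum of the squared first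
  power sum and the second power sum.\<close>

lemma divdiff_4_poly:
  assumes "p < q" "q < r" "r < (s::real)"
  shows "divdiff (\<lambda>x. c0 + c1 * x + c2 * x ^ 2 + c3 * x ^ 3 + c4 * x ^ 4 + c5 * x ^ 5) {p, q, r, s} =
    c3 + c4 * (p + q + r + s) + c5 * (((p + q + r + s)\<^sup>2 + (p\<^sup>2 + q\<^sup>2 + r\<^sup>2 + s\<^sup>2)) / 2)"
    (is "?l = ?r")
proof -
  let ?V = "(q - p) * (r - p) * (s - p) * (r - q) * (s - q) * (s - r)"
  have "2 * (?l * ?V) = (2 * c3 + 2 * c4 * (p + q + r + s)
      + c5 * ((p + q + r + s)\<^sup>2 + (p\<^sup>2 + q\<^sup>2 + r\<^sup>2 + s\<^sup>2))) * ?V"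
    unfolding divdiff_4[OF assms] by algebra
  also have "\<dots> = 2 * (?r * ?V)"
    by simp
  finally have "?l * ?V = ?r * ?V" by simp
  then show ?thesis using assms by simp
qed

lemma Rolle_real:
  fixes f f' :: "real \<Rightarrow> real"
  assumes "a < b" "f a = f b" "\<And>x. a \<le> x \<Longrightarrow> (f has_real_derivative f' x) (at x)"
  obtains z where "a < z" "z < b" "f' z = 0"
proof -
  have "continuous_on {a..b} f"
    by (intro continuous_at_imp_continuous_on ballI DERIV_isCont[OF assms(3)]) auto
  moreover have "f differentiable (at x)" if "a < x" "x < b" for x
    using assms(3)[of x] that by (auto simp: real_differentiable_def)
  ultimately obtain z where z: "a < z" "z < b" "(f has_real_derivative 0) (at z)"
    using Rolle[OF assms(1,2)] by blast
  with assms(3)[of z] have "f' z = 0" by (auto intro: DERIV_unique)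
  with z that show ?thesis by blast
qed

text \<open>By the mean value theorem the divided difference is one sixth of the third derivative at
  some point between the nodes.\<close>

lemma divdiff_nonneg:
  fixes f f1 f2 f3 :: "real \<Rightarrow> real"
  assumes S: "card S = 4" "S \<subseteq> {0<..}"
    and f1: "\<And>x. 0 < x \<Longrightarrow> (f has_real_derivative f1 x) (at x)"
    and f2: "\<And>x. 0 < x \<Longrightarrow> (f1 has_real_derivative f2 x) (at x)"
    and f3: "\<And>x. 0 < x \<Longrightarrow> (f2 has_real_derivative f3 x) (at x)"
    and nonneg: "\<And>x. 0 < x \<Longrightarrow> 0 \<le> f3 x"
  shows "0 \<le> divdiff f S"
proof -
  obtain p q r s where pqrs: "S = {p, q, r, s}" "p < q" "q < r" "r < s"
    using S(1) by (rule card_4_sorted)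
  have p: "0 < p" using S pqrs by auto
  \<comment> \<open>\<open>P\<close> is the cubic Newton interpolant of \<open>f\<close>; its leading coefficient is the divided difference.\<close>
  define d1 where "d1 = (f q - f p) / (q - p)"
  define d2 where "d2 = ((f r - f p) / (r - p) - d1) / (r - q)"
  define d3 where "d3 = (((f s - f p) / (s - p) - d1) / (s - q) - d2) / (s - r)"
  define P where "P x = f p + (x - p) * (d1 + (x - q) * (d2 + (x - r) * d3))" for x
  have P: "f x = P x" if "x \<in> S" for x
  proof -
    have "d1 * (q - p) = f q - f p" using pqrs by (simp add: d1_def)
    moreover have "(r - p) * (d1 + (r - q) * d2) = f r - f p" using pqrs by (simp add: d2_def)
    moreover have "(s - p) * (d1 + (s - q) * (d2 + (s - r) * d3)) = f s - f p" using pqrs by (simp add: d3_def)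
    ultimately show ?thesis using that pqrs by (auto simp: P_def mult.commute)
  qed
  define e0 where "e0 = f p + - p * (d1 + - q * (d2 - r * d3))"
  define e1 where "e1 = d1 + d2 * (- p - q) + d3 * (p * q + p * r + q * r)"
  define e2 where "e2 = d2 - d3 * (p + q + r)"
  have P_eq: "P = (\<lambda>x. e0 + e1 * x + e2 * x ^ 2 + d3 * x ^ 3 + 0 * x ^ 4 + 0 * x ^ 5)"
    by (simp add: P_def e0_def e1_def e2_def fun_eq_iff algebra_simps power2_eq_square power3_eq_cube)
  have "divdiff f S = divdiff P S" using P by (rule divdiff_cong)
  then have D: "divdiff f S = d3"
    unfolding pqrs(1) P_eq divdiff_4_poly[OF pqrs(2-4)] by simp
  define g where "g x = f x - P x" for x
  define g1 where "g1 x = f1 x - (e1 + 2 * e2 * x + 3 * d3 * x ^ 2)" for x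
  define g2 where "g2 x = f2 x - (2 * e2 + 6 * d3 * x)" for x
  define g3 where "g3 x = f3 x - 6 * d3" for x
  have g1: "(g has_real_derivative g1 x) (at x)" if "0 < x" for x
    unfolding g_def g1_def P_eq
    by (rule derivative_eq_intros f1 that refl | simp)+
  have g2: "(g1 has_real_derivative g2 x) (at x)" if "0 < x" for x
    unfolding g2_def g1_def
    by (rule derivative_eq_intros f2 that refl | simp)+
  have g3: "(g2 has_real_derivative g3 x) (at x)" if "0 < x" for x
    unfolding g2_def g3_def
    by (rule derivative_eq_intros f3 that refl | simp)+
  have zero: "g p = 0" "g q = 0" "g r = 0" "g s = 0"
    using P pqrs by (auto simp: g_def)
  \<comment> \<open>Repeated use of Rolle's theorem: four zeros of \<open>g\<close> give three of
    \<open>g1\<close>, two of \<open>g2\<close> and one of \<open>g3\<close>, where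
    \<open>f3 z = 6 * d3\<close>.\<close>
  obtain x1 where x1: "p < x1" "x1 < q" "g1 x1 = 0"
    using Rolle_real[of p q g g1] g1 zero pqrs p by auto
  obtain x2 where x2: "q < x2" "x2 < r" "g1 x2 = 0"
    using Rolle_real[of q r g g1] g1 zero pqrs p by auto
  obtain x3 where x3: "r < x3" "x3 < s" "g1 x3 = 0"
    using Rolle_real[of r s g g1] g1 zero pqrs p by auto
  obtain y1 where y1: "x1 < y1" "y1 < x2" "g2 y1 = 0"
    using Rolle_real[of x1 x2 g1 g2] g2 x1 x2 p by auto
  obtain y2 where y2: "x2 < y2" "y2 < x3" "g2 y2 = 0"
    using Rolle_real[of x2 x3 g1 g2] g2 x1 x2 x3 p by auto
  obtain z where z: "y1 < z" "z < y2" "g3 z = 0"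
    using Rolle_real[of y1 y2 g2 g3] g3 x1 y1 y2 p by auto
  have "0 \<le> f3 z" using nonneg z y1 x1 p by auto
  with z D show ?thesis by (simp add: g3_def)
qed

section \<open>Upper bounds for the divided difference of \<open>capfun\<close>\<close>

text \<open>The left-hand side is the third derivative of \<open>capfun\<close>. The quadratic on the right makes the
  resulting bound on the divided difference depend only on the first two power sums of the nodes.\<close>
lemma capfun_third_derivative_le:
  assumes "0 < b"
  shows "18 * tpow 2 (2 * sqrt b - 1) / b - 3 * tpow 3 (2 * sqrt b - 1) / (b * sqrt b)
    + 24 * tpow 1 (2 * sqrt b - 1) / sqrt b \<le> 3 * (8 * b - 1)\<^sup>2"
proof (cases "2 * sqrt b - 1 < 0")
  case True
  then show ?thesis by (simp add: tpow_def)
next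
  case False
  define a where "a = sqrt b"
  have a: "1 / 2 \<le> a" "0 < a" "b = a\<^sup>2" using False assms by (auto simp: a_def)
  \<comment> \<open>In \<open>a = sqrt b\<close> the third derivative is
    \<open>(96 * a ^ 3 - 60 * a\<^sup>2 + 3) / a ^ 3\<close>. It lies below
    \<open>96 * b - 24\<close>: the difference times \<open>a ^ 3\<close> is 3 times this
    product.\<close>
  have "0 \<le> (2 * a - 1) ^ 3 * (4 * a\<^sup>2 + 6 * a + 1)"
    using a by (intro mult_nonneg_nonneg zero_le_power) auto
  then have "96 * a ^ 3 - 60 * a\<^sup>2 + 3 \<le> (96 * a\<^sup>2 - 24) * a ^ 3"
    by (simp add: algebra_simps power2_eq_square eval_nat_numeral)
  also have "\<dots> \<le> (3 * (8 * a\<^sup>2 - 1)\<^sup>2) * a ^ 3"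
  proof (intro mult_right_mono)
    \<comment> \<open>The line \<open>96 * b - 24\<close> is tangent to the convex quadratic at
      \<open>b = 3 / 8\<close>.\<close>
    have "0 \<le> 3 * (8 * a\<^sup>2 - 3)\<^sup>2" by simp
    then show "96 * a\<^sup>2 - 24 \<le> 3 * (8 * a\<^sup>2 - 1)\<^sup>2"
      by (simp add: algebra_simps power2_eq_square)
  qed (use a in auto)
  finally have "(96 * a ^ 3 - 60 * a\<^sup>2 + 3) / a ^ 3 \<le> 3 * (8 * a\<^sup>2 - 1)\<^sup>2"
    using a by (simp add: field_simps)
  moreover have "18 * (2 * a - 1)\<^sup>2 / a\<^sup>2 - 3 * (2 * a - 1) ^ 3 / (a\<^sup>2 * a) + 24 * (2 * a - 1) / a
    = (96 * a ^ 3 - 60 * a\<^sup>2 + 3) / a ^ 3"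
    using a by (simp add: divide_simps) (simp add: algebra_simps power2_eq_square eval_nat_numeral)
  moreover have t: "tpow k (2 * sqrt b - 1) = (2 * a - 1) ^ k" for k
    using False by (simp add: tpow_def a_def)
  ultimately show ?thesis
    using a(2) unfolding t a_def[symmetric] a(3) by simp
qed

text \<open>\<open>h\<close> has third derivative \<open>3 * (8 * x - 1)\<^sup>2\<close>, so
  \<open>h - capfun\<close> has a nonnegative one, and the divided difference of the polynomial
  \<open>h\<close> is explicit.\<close>

lemma divdiff_capfun_le:
  assumes S: "card S = 4" "S \<subseteq> {0<..}"
  shows "divdiff capfun S \<le> 1 / 2 - 2 * (\<Sum>x\<in>S. x) + 8 / 5 * ((\<Sum>x\<in>S. x)\<^sup>2 + (\<Sum>x\<in>S. x\<^sup>2))"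
proof -
  define h :: "real \<Rightarrow> real" where "h x = 0 + 0 * x + 0 * x ^ 2 + 1 / 2 * x ^ 3 + - 2 * x ^ 4 + 16 / 5 * x ^ 5" for x
  define c where "c k x = tpow k (2 * sqrt x - 1)" for k x
  have c: "(c (Suc k) has_real_derivative Suc k * c k x / sqrt x) (at x)" if "0 < x" "0 < k" for k x
  proof -
    have "((\<lambda>x. tpow (Suc k) (2 * sqrt x - 1)) has_real_derivative
      (Suc k * tpow k (2 * sqrt x - 1)) * (1 / sqrt x)) (at x)"
      using that by (intro DERIV_chain2[OF has_real_derivative_tpow])
        (auto intro!: derivative_eq_intros simp: field_simps)
    then show ?thesis by (simp add: c_def[abs_def])
  qed
  have c4: "(c 4 has_real_derivative 4 * c 3 x / sqrt x) (at x)" if "0 < x" for x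
    using c[OF that, of 3] by (simp add: numeral_eq_Suc)
  have c3: "(c 3 has_real_derivative 3 * c 2 x / sqrt x) (at x)" if "0 < x" for x
    using c[OF that, of 2] by (simp add: numeral_eq_Suc)
  \<comment> \<open>The third derivative stops at \<open>c 1\<close>, so its kink at 1 / 4 is never
    differentiated.\<close>
  have c2: "(c 2 has_real_derivative 2 * c 1 x / sqrt x) (at x)" if "0 < x" for x
    using c[OF that, of 1] by (simp add: numeral_eq_Suc)
  have "0 \<le> divdiff (\<lambda>x. h x - capfun x) S"
  proof (rule divdiff_nonneg[OF S])
    fix x :: real assume x: "0 < x"
    have s: "sqrt x * sqrt x = x" "sqrt x \<noteq> 0" using x by auto
    have sqrt: "(sqrt has_real_derivative 1 / (2 * sqrt x)) (at x)"
      using DERIV_real_sqrt[OF x] by (simp add: field_simps)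
    have "(capfun has_real_derivative 1 * c 4 x + 4 * c 3 x / sqrt x * x) (at x)"
      unfolding capfun_def[abs_def] c_def[symmetric]
      by (rule DERIV_mult[OF DERIV_ident c4[OF x]])
    moreover have "(h has_real_derivative 3 / 2 * x ^ 2 - 8 * x ^ 3 + 16 * x ^ 4) (at x)"
      unfolding h_def[abs_def] by (auto intro!: derivative_eq_intros)
    ultimately have "((\<lambda>x. h x - capfun x) has_real_derivative
      (3 / 2 * x ^ 2 - 8 * x ^ 3 + 16 * x ^ 4) - (1 * c 4 x + 4 * c 3 x / sqrt x * x)) (at x)"
      by (intro DERIV_diff)
    then show "((\<lambda>x. h x - capfun x) has_real_derivative
      (3 / 2 * x ^ 2 - 8 * x ^ 3 + 16 * x ^ 4) - (c 4 x + 4 * (sqrt x * c 3 x))) (at x)"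
      by (rule DERIV_cong) (use s in \<open>simp add: field_simps\<close>)
    have "((\<lambda>x. 3 / 2 * x ^ 2 - 8 * x ^ 3 + 16 * x ^ 4) has_real_derivative
      3 * x - 24 * x ^ 2 + 64 * x ^ 3) (at x)"
      by (auto intro!: derivative_eq_intros)
    from DERIV_diff[OF this DERIV_add[OF c4[OF x] DERIV_cmult[where c = 4, OF DERIV_mult[OF sqrt c3[OF x]]]]]
    show "((\<lambda>x. (3 / 2 * x ^ 2 - 8 * x ^ 3 + 16 * x ^ 4) - (c 4 x + 4 * (sqrt x * c 3 x))) has_real_derivative
      (3 * x - 24 * x ^ 2 + 64 * x ^ 3) - (6 * (c 3 x / sqrt x) + 12 * c 2 x)) (at x)"
      by (rule DERIV_cong) (use s in \<open>simp add: field_simps\<close>)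
    have "((\<lambda>x. 3 * x - 24 * x ^ 2 + 64 * x ^ 3) has_real_derivative 3 * (8 * x - 1)\<^sup>2) (at x)"
      by (auto intro!: derivative_eq_intros simp: algebra_simps power2_eq_square)
    moreover have e: "(3 * c 2 x / sqrt x * sqrt x - c 3 x * (1 / (2 * sqrt x))) / (sqrt x * sqrt x) =
      3 * (c 2 x / x) - c 3 x / (x * sqrt x) / 2"
      unfolding s(1) using s(2) by (simp add: diff_divide_distrib mult.commute)
    note DERIV_diff[OF calculation DERIV_add[OF DERIV_cmult[where c = 6, OF DERIV_divide[OF c3[OF x] sqrt s(2)]]
        DERIV_cmult[where c = 12, OF c2[OF x]]]]
    then show "((\<lambda>x. (3 * x - 24 * x ^ 2 + 64 * x ^ 3) - (6 * (c 3 x / sqrt x) + 12 * c 2 x)) has_real_derivative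
      3 * (8 * x - 1)\<^sup>2 - (18 * c 2 x / x - 3 * c 3 x / (x * sqrt x) + 24 * c 1 x / sqrt x)) (at x)"
      by (rule DERIV_cong) (simp only: e, simp add: algebra_simps)
    show "0 \<le> 3 * (8 * x - 1)\<^sup>2 - (18 * c 2 x / x - 3 * c 3 x / (x * sqrt x) + 24 * c 1 x / sqrt x)"
      using capfun_third_derivative_le[OF x] by (simp add: c_def)
  qed
  moreover have "divdiff h S = 1 / 2 - 2 * (\<Sum>x\<in>S. x) + 8 / 5 * ((\<Sum>x\<in>S. x)\<^sup>2 + (\<Sum>x\<in>S. x\<^sup>2))"
  proof -
    obtain p q r s where pqrs: "S = {p, q, r, s}" "p < q" "q < r" "r < s"
      using S(1) by (rule card_4_sorted)
    have "(\<Sum>x\<in>S. f x) = f p + f q + f r + f s" for f :: "real \<Rightarrow> real"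
      using pqrs by (simp add: add.assoc)
    then show ?thesis
      unfolding h_def pqrs(1) divdiff_4_poly[OF pqrs(2-4)] by simp
  qed
  ultimately show ?thesis by (simp add: divdiff_diff)
qed

text \<open>Besides \<open>m\<close> at most one node contributes, and its contribution is not positive.\<close>
lemma divdiff_capfun_le_max:
  assumes S: "finite S" "m \<in> S" "\<And>x. x \<in> S - {m} \<Longrightarrow> x < m"
    and unique: "\<And>x y. x \<in> S - {m} \<Longrightarrow> y \<in> S - {m} \<Longrightarrow> 1 / 4 < x \<Longrightarrow> 1 / 4 < y \<Longrightarrow> x = y"
  shows "divdiff capfun S \<le> capfun m / (\<Prod>y\<in>S - {m}. m - y)"
proof -
  have "capfun x / (\<Prod>y\<in>S - {x}. x - y) \<le> 0" if x: "x \<in> S - {m}" for x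
  proof (cases "1 / 4 < x")
    case True
    have "S - {x} = insert m (S - {x} - {m})" using x S by auto
    then have "(\<Prod>y\<in>S - {x}. x - y) = (x - m) * (\<Prod>y\<in>S - {x} - {m}. x - y)"
      using S by (metis (no_types, lifting) Diff_iff finite_Diff insertI1 prod.insert)
    \<comment> \<open>By uniqueness the remaining nodes are at most 1 / 4 and hence below
      \<open>x\<close>, so \<open>x - m\<close> is the only negative factor.\<close>
    moreover have "0 \<le> (\<Prod>y\<in>S - {x} - {m}. x - y)"
      using unique[OF x _ True] True by (intro prod_nonneg) force
    ultimately have "(\<Prod>y\<in>S - {x}. x - y) \<le> 0"
      using S(3)[OF x] by (simp add: mult_nonpos_nonneg)
    moreover have "0 \<le> capfun x" using True by (simp add: capfun_def)
    ultimately show ?thesis by (simp add: divide_nonneg_nonpos)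
  next
    case False
    then show ?thesis by (simp add: capfun_eq_0)
  qed
  then have "(\<Sum>x\<in>S - {m}. capfun x / (\<Prod>y\<in>S - {x}. x - y)) \<le> 0"
    by (intro sum_nonpos) auto
  then show ?thesis
    using sum.remove[OF S(1,2), of "\<lambda>x. capfun x / (\<Prod>y\<in>S - {x}. x - y)"] by (simp add: divdiff_def)
qed

lemma divdiff_capfun_eq:
  assumes "finite S" "m \<in> S" "\<And>x. x \<in> S - {m} \<Longrightarrow> x \<le> 1 / 4"
  shows "divdiff capfun S = capfun m / (\<Prod>y\<in>S - {m}. m - y)"
proof -
  have "(\<Sum>x\<in>S - {m}. capfun x / (\<Prod>y\<in>S - {x}. x - y)) = 0"
    using assms by (intro sum.neutral) (auto simp: capfun_eq_0)
  then show ?thesis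
    using sum.remove[OF assms(1,2), of "\<lambda>x. capfun x / (\<Prod>y\<in>S - {x}. x - y)"] by (simp add: divdiff_def)
qed

section \<open>Approximation by caps with generic normals\<close>

text \<open>Hoelder's inequality, with l1 norm at most 2 on \<open>B\<close>. Dividing the normal by
  \<open>1 - 2 * e\<close> or \<open>1 + 2 * e\<close> compensates for this error in the inclusions
  below.\<close>

lemma inner_diff_le_on_B:
  assumes "x \<in> B" "\<And>i. \<bar>a $ i - u $ i\<bar> \<le> e"
  shows "\<bar>x \<bullet> a - x \<bullet> u\<bar> \<le> 2 * e"
proof -
  have "x \<bullet> a - x \<bullet> u = (\<Sum>i\<in>UNIV. x $ i * (a $ i - u $ i))"
    by (simp add: inner_vec_def sum_subtractf right_diff_distrib)
  also have "\<bar>\<dots>\<bar> \<le> (\<Sum>i\<in>UNIV. \<bar>x $ i\<bar> * e)"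
    by (rule order_trans[OF sum_abs]) (auto simp: abs_mult intro!: sum_mono mult_left_mono assms)
  also have "\<dots> = (\<bar>x $ 0\<bar> + \<bar>x $ 1\<bar> + \<bar>x $ 2\<bar> + \<bar>x $ 3\<bar>) * e"
    by (simp add: sum_4' distrib_right)
  also have "\<dots> \<le> 2 * e"
    using assms(1) order_trans[OF abs_ge_zero assms(2)] by (intro mult_right_mono) (auto simp: B_def)
  finally show ?thesis .
qed

lemma cap_subset_scaled:
  assumes "\<And>i. \<bar>a $ i - u $ i\<bar> \<le> e" "2 * e < 1"
  shows "cap u \<subseteq> cap ((1 / (1 - 2 * e)) *\<^sub>R a)"
proof
  fix x assume "x \<in> cap u"
  then have "x \<in> B" "1 \<le> x \<bullet> u" by (auto simp: cap_def)
  with inner_diff_le_on_B[OF this(1) assms(1)] have "1 - 2 * e \<le> x \<bullet> a" by linarith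
  with \<open>x \<in> B\<close> assms(2) show "x \<in> cap ((1 / (1 - 2 * e)) *\<^sub>R a)"
    by (simp add: cap_def field_simps)
qed

lemma scaled_cap_subset:
  assumes "\<And>i. \<bar>a $ i - u $ i\<bar> \<le> e" "0 \<le> e"
  shows "cap ((1 / (1 + 2 * e)) *\<^sub>R a) \<subseteq> cap u"
proof
  fix x assume x: "x \<in> cap ((1 / (1 + 2 * e)) *\<^sub>R a)"
  then have "x \<in> B" by (simp add: cap_def)
  moreover have "1 + 2 * e \<le> x \<bullet> a" using x assms(2) by (simp add: cap_def field_simps)
  ultimately show "x \<in> cap u"
    using inner_diff_le_on_B[OF _ assms(1), of x] by (auto simp: cap_def)
qed

lemma measure_cap_mono: "cap a \<subseteq> cap u \<Longrightarrow> measure lebesgue (cap a) \<le> measure lebesgue (cap u)"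
  by (intro measure_mono_fmeasurable cap_lmeasurable) (simp_all add: cap_lmeasurable fmeasurableD)

lemma prod_range_diff:
  fixes b :: "'i \<Rightarrow> real"
  assumes "inj b"
  shows "(\<Prod>y\<in>range b - {b k}. b k - y) = (\<Prod>j\<in>UNIV - {k}. b k - b j)"
proof -
  have "range b - {b k} = b ` (UNIV - {k})" using assms by (auto simp: inj_def)
  then show ?thesis using assms by (simp add: prod.reindex inj_on_subset)
qed

text \<open>A perturbation of \<open>u\<close> with nonzero entries of distinct absolute values; the scaling factor makes
  its cap contain (\<open>\<sigma> = -1\<close>) or lie in (\<open>\<sigma> = 1\<close>) the cap of \<open>u\<close>, so no continuity of the volume is
  needed.\<close>
definition pert :: "real \<Rightarrow> real ^ 4 \<Rightarrow> real \<Rightarrow> real ^ 4"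
  where "pert \<sigma> u t = (1 / (1 + 2 * (\<sigma> * 4 * t))) *\<^sub>R
    (\<chi> i. (if u $ i < 0 then - 1 else 1) * (\<bar>u $ i\<bar> + vec4 1 2 3 4 $ i * t))"

lemma vec4_1234: "1 \<le> vec4 1 2 3 4 $ i" "vec4 1 2 3 4 $ i \<le> 4"
  "i \<noteq> j \<Longrightarrow> vec4 1 2 3 4 $ i \<noteq> vec4 1 2 3 4 $ j"
  unfolding vec4_def by auto (metis UNIV_4' UNIV_I empty_iff insert_iff)+

lemma pert_error:
  assumes "0 \<le> t"
  shows "\<bar>(\<chi> i. (if u $ i < 0 then - 1 else 1) * (\<bar>u $ i\<bar> + vec4 1 2 3 4 $ i * t)) $ i - u $ i\<bar> \<le> 4 * t"
proof -
  have "0 \<le> vec4 1 2 3 4 $ i * t" "vec4 1 2 3 4 $ i * t \<le> 4 * t"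
    using vec4_1234[of i] assms by (auto intro!: mult_right_mono)
  then show ?thesis by (auto simp: abs_if)
qed

lemma measure_cap_le_pert:
  assumes "0 \<le> t" "8 * t < 1"
  shows "measure lebesgue (cap u) \<le> measure lebesgue (cap (pert (- 1) u t))"
  unfolding pert_def
  using cap_subset_scaled[OF pert_error[OF assms(1), of u]] assms(2)
  by (intro measure_cap_mono) simp

lemma measure_cap_pert_le:
  assumes "0 \<le> t"
  shows "measure lebesgue (cap (pert 1 u t)) \<le> measure lebesgue (cap u)"
  unfolding pert_def
  using scaled_cap_subset[OF pert_error[OF assms(1), of u]] assms
  by (intro measure_cap_mono) simp

lemma pert_square: "(pert \<sigma> u t $ i)\<^sup>2 = ((\<bar>u $ i\<bar> + vec4 1 2 3 4 $ i * t) / (1 + 8 * \<sigma> * t))\<^sup>2"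
  by (simp add: pert_def power_divide power_mult_distrib mult.assoc)

lemma eventually_small: "eventually (\<lambda>t. 0 < t \<and> 8 * t < (1::real)) (at_right 0)"
  unfolding eventually_at_right_field by (rule exI[of _ "1/8"]) auto

text \<open>The weights 1, 2, 3, 4 differ, so two perturbed absolute values agree for at most one
  \<open>t\<close>. The finitely many such \<open>t\<close> are avoided near 0.\<close>

lemma eventually_pert_generic:
  assumes "\<sigma> = 1 \<or> \<sigma> = - 1"
  shows "eventually (\<lambda>t. inj (\<lambda>i. (pert \<sigma> u t $ i)\<^sup>2) \<and> (\<forall>i. pert \<sigma> u t $ i \<noteq> 0)) (at_right 0)"
proof -
  let ?d = "\<lambda>i. vec4 1 2 3 4 $ i"
  \<comment> \<open>For \<open>i = j\<close> the quotient is 0 by the convention on division, which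
    is also avoided.\<close>
  have "eventually (\<lambda>t. t \<noteq> (\<bar>u $ j\<bar> - \<bar>u $ i\<bar>) / (?d i - ?d j)) (at_right 0)" for i j
    by (rule eventually_neq_at_within)
  then have "eventually (\<lambda>t. \<forall>i j. t \<noteq> (\<bar>u $ j\<bar> - \<bar>u $ i\<bar>) / (?d i - ?d j)) (at_right 0)"
    by (intro eventually_all_finite) auto
  with eventually_small show ?thesis
  proof eventually_elim
    case (elim t)
    have c: "0 < 1 + 8 * \<sigma> * t" using assms by (elim disjE) (use elim in auto)
    have pos: "0 < (\<bar>u $ i\<bar> + ?d i * t) / (1 + 8 * \<sigma> * t)" for i
      using elim vec4_1234(1)[of i] c by (intro divide_pos_pos[OF _ c] add_nonneg_pos mult_pos_pos) auto
    have "inj (\<lambda>i. (pert \<sigma> u t $ i)\<^sup>2)"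
    proof (rule injI, rule ccontr)
      fix i j assume e: "(pert \<sigma> u t $ i)\<^sup>2 = (pert \<sigma> u t $ j)\<^sup>2" and "i \<noteq> j"
      have "\<bar>u $ i\<bar> + ?d i * t = \<bar>u $ j\<bar> + ?d j * t"
        using e pos[of i] pos[of j] c unfolding pert_square by (simp add: power2_eq_iff_nonneg)
      then have "t = (\<bar>u $ j\<bar> - \<bar>u $ i\<bar>) / (?d i - ?d j)"
        using vec4_1234(3)[OF \<open>i \<noteq> j\<close>] by (simp add: field_simps)
      with elim show False by blast
    qed
    moreover have "pert \<sigma> u t $ i \<noteq> 0" for i
      using pos[of i] pert_square[of \<sigma> u t i] by auto
    ultimately show ?case by blast
  qed
qed

lemma tendsto_pert: "((\<lambda>t. (pert \<sigma> u t $ i)\<^sup>2) \<longlongrightarrow> (u $ i)\<^sup>2) (at_right 0)"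
proof -
  have "((\<lambda>t. ((\<bar>u $ i\<bar> + vec4 1 2 3 4 $ i * t) / (1 + 8 * \<sigma> * t))\<^sup>2) \<longlongrightarrow>
    ((\<bar>u $ i\<bar> + vec4 1 2 3 4 $ i * 0) / (1 + 8 * \<sigma> * 0))\<^sup>2) (at_right 0)"
    by (intro tendsto_intros) auto
  then show ?thesis by (simp add: pert_square)
qed

section \<open>Volume bounds for all normals, as limits of the generic ones\<close>

text \<open>The bound of \<open>divdiff_capfun_le\<close> depends only on power sums and survives
  the collision of nodes. With first power sum 1 its constant is 1 / 2 - 2 + 8 / 5 = 1 / 10.\<close>

lemma measure_cap_le_spread:
  fixes u :: "real ^ 4"
  assumes u: "(\<Sum>i\<in>UNIV. (u $ i)\<^sup>2) = 1"
  shows "measure lebesgue (cap u) \<le> (1 / 10 + 8 / 5 * (\<Sum>i\<in>UNIV. ((u $ i)\<^sup>2)\<^sup>2)) / 3"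
proof -
  define b where "b t i = (pert (- 1) u t $ i)\<^sup>2" for t i
  define F where "F b = (1 / 2 - 2 * (\<Sum>i\<in>UNIV. b i) + 8 / 5 * ((\<Sum>i\<in>UNIV. b i)\<^sup>2 + (\<Sum>i\<in>UNIV. (b i)\<^sup>2))) / 3"
    for b :: "4 \<Rightarrow> real"
  have "((\<lambda>t. F (b t)) \<longlongrightarrow> F (\<lambda>i. (u $ i)\<^sup>2)) (at_right 0)"
    unfolding F_def b_def by (intro tendsto_intros tendsto_pert) auto
  moreover have "eventually (\<lambda>t. measure lebesgue (cap u) \<le> F (b t)) (at_right 0)"
    using eventually_small eventually_pert_generic[of "- 1" u, simplified]
  proof eventually_elim
    case (elim t)
    then have inj: "inj (b t)" by (simp add: b_def[abs_def])
    have "measure lebesgue (cap u) \<le> measure lebesgue (cap (pert (- 1) u t))"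
      using elim by (intro measure_cap_le_pert) auto
    also have "\<dots> = divdiff capfun (range (b t)) / 3"
      unfolding b_def using elim by (intro measure_cap) auto
    also have "\<dots> \<le> F (b t)"
    proof -
      have "card (range (b t)) = 4" using inj by (simp add: card_image)
      moreover have "range (b t) \<subseteq> {0<..}" using elim by (auto simp: b_def)
      ultimately show ?thesis
        using divdiff_capfun_le[of "range (b t)"] unfolding F_def by (simp add: sum.reindex[OF inj])
    qed
    finally show ?case .
  qed
  ultimately have "measure lebesgue (cap u) \<le> F (\<lambda>i. (u $ i)\<^sup>2)"
    by (intro tendsto_lowerbound) auto
  then show ?thesis unfolding F_def u by (simp add: field_simps)
qed

lemma continuous_on_capfun: "continuous_on UNIV capfun"
proof -
  have "continuous_on UNIV (\<lambda>b. b * tpow (Suc 3) (2 * sqrt b - 1))"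
    by (intro continuous_intros)
  then show ?thesis
    by (rule continuous_on_eq) (simp add: capfun_def numeral_eq_Suc)
qed

text \<open>The denominator contains only differences with node \<open>k\<close>, so the other nodes
  may coincide in the limit.\<close>

lemma tendsto_capfun_ratio:
  fixes u :: "real ^ 4"
  assumes "\<And>j. j \<noteq> k \<Longrightarrow> (u $ j)\<^sup>2 \<noteq> (u $ k)\<^sup>2"
  shows "((\<lambda>t. capfun ((pert \<sigma> u t $ k)\<^sup>2) / (\<Prod>j\<in>UNIV - {k}. (pert \<sigma> u t $ k)\<^sup>2 - (pert \<sigma> u t $ j)\<^sup>2) / 3)
    \<longlongrightarrow> capfun ((u $ k)\<^sup>2) / (\<Prod>j\<in>UNIV - {k}. (u $ k)\<^sup>2 - (u $ j)\<^sup>2) / 3) (at_right 0)"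
proof -
  have "isCont capfun x" for x
    using continuous_on_capfun by (simp add: continuous_on_eq_continuous_at)
  then have "((\<lambda>t. capfun ((pert \<sigma> u t $ k)\<^sup>2)) \<longlongrightarrow> capfun ((u $ k)\<^sup>2)) (at_right 0)"
    by (rule isCont_tendsto_compose) (rule tendsto_pert)
  moreover have "(u $ k)\<^sup>2 - (u $ j)\<^sup>2 \<noteq> 0" if "j \<noteq> k" for j
    using assms[OF that] by linarith
  then have "(\<Prod>j\<in>UNIV - {k}. (u $ k)\<^sup>2 - (u $ j)\<^sup>2) \<noteq> 0"
    by (subst prod_zero_iff) auto
  ultimately show ?thesis
    by (intro tendsto_intros tendsto_pert) auto
qed

text \<open>Both hypotheses are strict and persist under small perturbations. The second leaves at
  most one node besides \<open>k\<close> above 1 / 4, as \<open>divdiff_capfun_le_max\<close>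
  demands.\<close>

lemma measure_cap_le_peak:
  fixes u :: "real ^ 4"
  assumes lt: "\<And>j. j \<noteq> k \<Longrightarrow> (u $ j)\<^sup>2 < (u $ k)\<^sup>2"
    and small: "\<And>i j. i \<noteq> j \<Longrightarrow> i \<noteq> k \<Longrightarrow> j \<noteq> k \<Longrightarrow> (u $ i)\<^sup>2 + (u $ j)\<^sup>2 < 1 / 2"
  shows "measure lebesgue (cap u) \<le> capfun ((u $ k)\<^sup>2) / (\<Prod>j\<in>UNIV - {k}. (u $ k)\<^sup>2 - (u $ j)\<^sup>2) / 3"
proof -
  define b where "b t i = (pert (- 1) u t $ i)\<^sup>2" for t i
  have b: "((\<lambda>t. b t i) \<longlongrightarrow> (u $ i)\<^sup>2) (at_right 0)" for i
    unfolding b_def by (rule tendsto_pert)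
  have "eventually (\<lambda>t. j \<noteq> k \<longrightarrow> b t j < b t k) (at_right 0)" for j
    using order_tendstoD(1)[OF tendsto_diff[OF b[of k] b[of j]], of 0] lt[of j]
    by (cases "j = k") auto
  then have 1: "eventually (\<lambda>t. \<forall>j. j \<noteq> k \<longrightarrow> b t j < b t k) (at_right 0)"
    by (rule eventually_all_finite)
  have "eventually (\<lambda>t. i \<noteq> j \<longrightarrow> i \<noteq> k \<longrightarrow> j \<noteq> k \<longrightarrow> b t i + b t j < 1 / 2) (at_right 0)" for i j
    using order_tendstoD(2)[OF tendsto_add[OF b b] small[of i j]]
    by (cases "i \<noteq> j \<and> i \<noteq> k \<and> j \<noteq> k") auto
  then have 2: "eventually (\<lambda>t. \<forall>i j. i \<noteq> j \<longrightarrow> i \<noteq> k \<longrightarrow> j \<noteq> k \<longrightarrow> b t i + b t j < 1 / 2) (at_right 0)"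
    by (intro eventually_all_finite)
  have "eventually (\<lambda>t. measure lebesgue (cap u) \<le>
      capfun (b t k) / (\<Prod>j\<in>UNIV - {k}. b t k - b t j) / 3) (at_right 0)"
    using eventually_small eventually_pert_generic[of "- 1" u, simplified] 1 2
  proof eventually_elim
    case (elim t)
    then have inj: "inj (b t)" by (simp add: b_def[abs_def])
    have "measure lebesgue (cap u) \<le> measure lebesgue (cap (pert (- 1) u t))"
      using elim by (intro measure_cap_le_pert) auto
    also have "\<dots> = divdiff capfun (range (b t)) / 3"
      unfolding b_def using elim by (intro measure_cap) auto
    also have "divdiff capfun (range (b t)) \<le> capfun (b t k) / (\<Prod>y\<in>range (b t) - {b t k}. b t k - y)"
    proof (rule divdiff_capfun_le_max)
      show "x < b t k" if "x \<in> range (b t) - {b t k}" for x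
        using that elim by auto
      show "x = y" if xy: "x \<in> range (b t) - {b t k}" "y \<in> range (b t) - {b t k}" "1 / 4 < x" "1 / 4 < y" for x y
      proof (rule ccontr)
        assume "x \<noteq> y"
        obtain i j where ij: "x = b t i" "y = b t j" using xy by auto
        with xy \<open>x \<noteq> y\<close> have "i \<noteq> j" "i \<noteq> k" "j \<noteq> k" by auto
        with elim have "b t i + b t j < 1 / 2" by blast
        with xy ij show False by simp
      qed
    qed auto
    finally show ?case unfolding prod_range_diff[OF inj] by (simp add: divide_right_mono)
  qed
  moreover have "((\<lambda>t. capfun (b t k) / (\<Prod>j\<in>UNIV - {k}. b t k - b t j) / 3) \<longlongrightarrow>
     capfun ((u $ k)\<^sup>2) / (\<Prod>j\<in>UNIV - {k}. (u $ k)\<^sup>2 - (u $ j)\<^sup>2) / 3) (at_right 0)"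
    unfolding b_def using lt by (intro tendsto_capfun_ratio) (auto dest: less_imp_neq)
  ultimately show ?thesis
    by (intro tendsto_lowerbound) auto
qed

text \<open>The lower bound for the equality case. The perturbed caps inside \<open>cap u\<close>
  have only node \<open>k\<close> above 1 / 4, so their volume is a single term, with limit 1 /
  3.\<close>

lemma measure_cap_axis_ge:
  fixes u :: "real ^ 4"
  assumes k: "\<bar>u $ k\<bar> = 1" and z: "\<And>j. j \<noteq> k \<Longrightarrow> u $ j = 0"
  shows "1 / 3 \<le> measure lebesgue (cap u)"
proof -
  have uk: "(u $ k)\<^sup>2 = 1" using k by (metis power2_abs one_power2)
  define b where "b t i = (pert 1 u t $ i)\<^sup>2" for t i
  have b: "((\<lambda>t. b t i) \<longlongrightarrow> (u $ i)\<^sup>2) (at_right 0)" for i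
    unfolding b_def by (rule tendsto_pert)
  have "eventually (\<lambda>t. j \<noteq> k \<longrightarrow> b t j < 1 / 4) (at_right 0)" for j
    using order_tendstoD(2)[OF b, of j "1 / 4"] z[of j] by (cases "j = k") auto
  then have 1: "eventually (\<lambda>t. \<forall>j. j \<noteq> k \<longrightarrow> b t j < 1 / 4) (at_right 0)"
    by (rule eventually_all_finite)
  have "eventually (\<lambda>t. capfun (b t k) / (\<Prod>j\<in>UNIV - {k}. b t k - b t j) / 3
      \<le> measure lebesgue (cap u)) (at_right 0)"
    using eventually_small eventually_pert_generic[of 1 u, simplified] 1
  proof eventually_elim
    case (elim t)
    then have inj: "inj (b t)" by (simp add: b_def[abs_def])
    have "capfun (b t k) / (\<Prod>j\<in>UNIV - {k}. b t k - b t j) / 3 = divdiff capfun (range (b t)) / 3"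
      unfolding prod_range_diff[OF inj, symmetric]
      using elim by (subst divdiff_capfun_eq[of _ "b t k"]) (auto intro: less_imp_le)
    also have "\<dots> = measure lebesgue (cap (pert 1 u t))"
      unfolding b_def using elim by (intro measure_cap[symmetric]) auto
    also have "\<dots> \<le> measure lebesgue (cap u)"
      using elim by (intro measure_cap_pert_le) auto
    finally show ?case .
  qed
  moreover have "((\<lambda>t. capfun (b t k) / (\<Prod>j\<in>UNIV - {k}. b t k - b t j) / 3) \<longlongrightarrow>
     capfun ((u $ k)\<^sup>2) / (\<Prod>j\<in>UNIV - {k}. (u $ k)\<^sup>2 - (u $ j)\<^sup>2) / 3) (at_right 0)"
    unfolding b_def using z uk by (intro tendsto_capfun_ratio) auto
  ultimately have "capfun ((u $ k)\<^sup>2) / (\<Prod>j\<in>UNIV - {k}. (u $ k)\<^sup>2 - (u $ j)\<^sup>2) / 3 \<le> measure lebesgue (cap u)"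
    by (intro tendsto_upperbound) auto
  moreover have "(\<Prod>j\<in>UNIV - {k}. (u $ k)\<^sup>2 - (u $ j)\<^sup>2) = 1"
    using z uk by (intro prod.neutral) auto
  moreover have "capfun 1 = 1" by (simp add: capfun_def tpow_def)
  ultimately show ?thesis by (simp add: uk)
qed

section \<open>The dominant coordinate and the case distinction at 9 / 16\<close>

lemma capfun_ratio_peak:
  fixes u :: "real ^ 4"
  assumes u: "(\<Sum>i\<in>UNIV. (u $ i)\<^sup>2) = 1" and k: "9 / 16 \<le> (u $ k)\<^sup>2"
  shows "capfun ((u $ k)\<^sup>2) / (\<Prod>j\<in>UNIV - {k}. (u $ k)\<^sup>2 - (u $ j)\<^sup>2) \<le> 1"
    and "(u $ k)\<^sup>2 < 1 \<Longrightarrow> capfun ((u $ k)\<^sup>2) / (\<Prod>j\<in>UNIV - {k}. (u $ k)\<^sup>2 - (u $ j)\<^sup>2) < 1"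
proof -
  define a where "a = \<bar>u $ k\<bar>"
  have a2: "(u $ k)\<^sup>2 = a\<^sup>2" by (simp add: a_def)
  have a: "3 / 4 \<le> a" using k power2_le_imp_le[of "3 / 4" a] by (simp add: a_def power2_eq_square)
  have card: "card (UNIV - {k}) = 3" by simp
  then obtain p q r where pqr: "UNIV - {k} = {p, q, r}" "p \<noteq> q" "p \<noteq> r" "q \<noteq> r"
    by (metis card_3_iff)
  define x where "x = (u $ p)\<^sup>2"
  define y where "y = (u $ q)\<^sup>2"
  define z where "z = (u $ r)\<^sup>2"
  have xyz: "0 \<le> x" "0 \<le> y" "0 \<le> z" by (auto simp: x_def y_def z_def)
  have "(\<Sum>i\<in>UNIV. (u $ i)\<^sup>2) = (u $ k)\<^sup>2 + (\<Sum>i\<in>UNIV - {k}. (u $ i)\<^sup>2)"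
    by (rule sum.remove) auto
  then have s: "x + y + z = 1 - a\<^sup>2"
    unfolding u pqr a2 using pqr by (simp add: x_def y_def z_def)
  have a1: "a\<^sup>2 \<le> 1" "9 / 16 \<le> a\<^sup>2" using s xyz k a2 by auto
  then have a1': "a \<le> 1" using a by (simp add: power2_eq_square power_le_one_iff abs_square_le_1[unfolded power2_eq_square])
  have P: "(\<Prod>j\<in>UNIV - {k}. a\<^sup>2 - (u $ j)\<^sup>2) = (a\<^sup>2 - x) * (a\<^sup>2 - y) * (a\<^sup>2 - z)"
    unfolding pqr using pqr by (simp add: x_def y_def z_def mult.assoc)
  have "a\<^sup>2 * (a\<^sup>2 * (2 * a\<^sup>2 - 1)) \<le> (a\<^sup>2 - x) * (a\<^sup>2 - y) * (a\<^sup>2 - z)"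
  proof -
    \<comment> \<open>Dropping nonnegative products such as x y twice moves the whole remaining mass
      \<open>1 - a\<^sup>2\<close> onto one coordinate, the worst case.\<close>
    have "a\<^sup>2 * (a\<^sup>2 * (2 * a\<^sup>2 - 1)) = a\<^sup>2 * (a\<^sup>2 * (a\<^sup>2 - (x + y + z)))" using s by simp
    also have "\<dots> \<le> a\<^sup>2 * (a\<^sup>2 - (x + y)) * (a\<^sup>2 - z)"
      using xyz by (simp add: algebra_simps)
    also have "\<dots> \<le> (a\<^sup>2 - x) * (a\<^sup>2 - y) * (a\<^sup>2 - z)"
      using xyz s a1 by (intro mult_right_mono) (simp_all add: algebra_simps)
    finally show ?thesis .
  qed
  moreover have pos: "0 < a\<^sup>2 * (a\<^sup>2 * (2 * a\<^sup>2 - 1))"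
    using a a1 by (intro mult_pos_pos) auto
  ultimately have le: "capfun (a\<^sup>2) / ((a\<^sup>2 - x) * (a\<^sup>2 - y) * (a\<^sup>2 - z)) \<le> capfun (a\<^sup>2) / (a\<^sup>2 * (a\<^sup>2 * (2 * a\<^sup>2 - 1)))"
    using a by (intro divide_left_mono) (auto simp: capfun_def)
  have c: "capfun (a\<^sup>2) = a\<^sup>2 * (2 * a - 1) ^ 4"
    using a by (simp add: capfun_def tpow_def)
  have f: "a\<^sup>2 * (2 * a\<^sup>2 - 1) - (2 * a - 1) ^ 4 = (1 - a) * (14 * a ^ 3 - 18 * a\<^sup>2 + 7 * a - 1)"
    by (simp add: algebra_simps power2_eq_square eval_nat_numeral)
  \<comment> \<open>Expanded around 3 / 4 the cubic has only positive coefficients.\<close>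
  define e where "e = a - 3 / 4"
  have "14 * a ^ 3 - 18 * a\<^sup>2 + 7 * a - 1 = 14 * e ^ 3 + 27 / 2 * e\<^sup>2 + 29 / 8 * e + 1 / 32"
    by (simp add: e_def field_simps power2_eq_square power3_eq_cube)
  also have "\<dots> > 0" using a by (intro add_nonneg_pos add_nonneg_nonneg mult_nonneg_nonneg) (auto simp: e_def)
  finally have g: "0 < 14 * a ^ 3 - 18 * a\<^sup>2 + 7 * a - 1" .
  have "(2 * a - 1) ^ 4 \<le> a\<^sup>2 * (2 * a\<^sup>2 - 1)"
    using f mult_nonneg_nonneg[of "1 - a", OF _ less_imp_le[OF g]] a1' by linarith
  then have "capfun (a\<^sup>2) \<le> a\<^sup>2 * (a\<^sup>2 * (2 * a\<^sup>2 - 1))"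
    unfolding c by (rule mult_left_mono) simp
  then have "capfun (a\<^sup>2) / (a\<^sup>2 * (a\<^sup>2 * (2 * a\<^sup>2 - 1))) \<le> 1"
    using pos by (simp only: divide_le_eq_1_pos)
  with le show "capfun ((u $ k)\<^sup>2) / (\<Prod>j\<in>UNIV - {k}. (u $ k)\<^sup>2 - (u $ j)\<^sup>2) \<le> 1"
    unfolding a2 P by linarith
  assume "(u $ k)\<^sup>2 < 1"
  then have "a < 1" using a1' a2 by (cases "a = 1") auto
  then have "(2 * a - 1) ^ 4 < a\<^sup>2 * (2 * a\<^sup>2 - 1)"
    using f mult_pos_pos[of "1 - a", OF _ g] by linarith
  then have "capfun (a\<^sup>2) < a\<^sup>2 * (a\<^sup>2 * (2 * a\<^sup>2 - 1))"
    unfolding c by (rule mult_strict_left_mono) (use a in simp)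
  then have "capfun (a\<^sup>2) / (a\<^sup>2 * (a\<^sup>2 * (2 * a\<^sup>2 - 1))) < 1"
    using pos by (simp only: divide_less_eq_1_pos)
  with le show "capfun ((u $ k)\<^sup>2) / (\<Prod>j\<in>UNIV - {k}. (u $ k)\<^sup>2 - (u $ j)\<^sup>2) < 1"
    unfolding a2 P by linarith
qed

theorem theorem13p6:
  fixes u :: "real ^ 4"
  assumes "norm u = 1"
  shows "measure lebesgue (B \<inter> {x. x \<bullet> u \<ge> 1}) \<le> 1 / 3
    \<and> (measure lebesgue (B \<inter> {x. x \<bullet> u \<ge> 1}) = 1 / 3
        \<longleftrightarrow> (\<exists>k :: 4. u = axis k 1 \<or> u = - axis k 1))"
proof -
  have u: "(\<Sum>i\<in>UNIV. (u $ i)\<^sup>2) = 1"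
    using assms power2_norm_eq_inner[of u] by (simp add: inner_vec_def power2_eq_square)
  have rest: "(\<Sum>i\<in>UNIV - {k}. (u $ i)\<^sup>2) = 1 - (u $ k)\<^sup>2" for k
    using u sum.remove[of UNIV k "\<lambda>i. (u $ i)\<^sup>2"] by simp
  have axis_iff: "(\<exists>k. u = axis k 1 \<or> u = - axis k 1) \<longleftrightarrow> (\<exists>k. (u $ k)\<^sup>2 = 1)"
  proof
    assume "\<exists>k. u = axis k 1 \<or> u = - axis k 1"
    then show "\<exists>k. (u $ k)\<^sup>2 = 1" by (auto simp: axis_def)
  next
    assume "\<exists>k. (u $ k)\<^sup>2 = 1"
    then obtain k where k: "(u $ k)\<^sup>2 = 1" by blast
    then have "(\<Sum>i\<in>UNIV - {k}. (u $ i)\<^sup>2) = 0" using rest[of k] by simp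
    then have "\<forall>i\<in>UNIV - {k}. (u $ i)\<^sup>2 = 0" by (subst (asm) sum_nonneg_eq_0_iff) auto
    then have "u $ i = 0" if "i \<noteq> k" for i using that by auto
    moreover have "u $ k = 1 \<or> u $ k = - 1" using k by (simp add: power2_eq_1_iff)
    ultimately have "u = axis k 1 \<or> u = - axis k 1"
      by (auto simp: vec_eq_iff axis_def)
    then show "\<exists>k. u = axis k 1 \<or> u = - axis k 1" by blast
  qed
  have "measure lebesgue (cap u) \<le> 1 / 3 \<and> (measure lebesgue (cap u) = 1 / 3 \<longleftrightarrow> (\<exists>k. (u $ k)\<^sup>2 = 1))"
  proof (cases "\<exists>k. 9 / 16 \<le> (u $ k)\<^sup>2")
    case False
    then have lt: "(u $ k)\<^sup>2 < 9 / 16" for k by (simp add: not_le)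
    \<comment> \<open>The threshold 9 / 16 is chosen so that 1 / 10 + 8 / 5 * 9 / 16 = 1. A nonzero
      coordinate makes the estimate strict.\<close>
    have "(\<Sum>i\<in>UNIV. ((u $ i)\<^sup>2)\<^sup>2) < 9 / 16"
    proof -
      obtain k where "u $ k \<noteq> 0" using u by (metis (no_types, lifting) sum.neutral zero_neq_one zero_power2)
      moreover have sq: "((u $ i)\<^sup>2)\<^sup>2 \<le> 9 / 16 * (u $ i)\<^sup>2"
        "u $ i \<noteq> 0 \<Longrightarrow> ((u $ i)\<^sup>2)\<^sup>2 < 9 / 16 * (u $ i)\<^sup>2" for i
        unfolding power2_eq_square[of "(u $ i)\<^sup>2"] using lt[of i]
        by (simp_all only: mult_right_mono mult_strict_right_mono less_imp_le zero_le_power2 zero_less_power2 simp_thms)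
      ultimately have "(\<Sum>i\<in>UNIV. ((u $ i)\<^sup>2)\<^sup>2) < (\<Sum>i\<in>UNIV. 9 / 16 * (u $ i)\<^sup>2)"
        using sq by (intro sum_strict_mono_ex1 bexI[of _ k]) auto
      also have "\<dots> = 9 / 16" unfolding sum_distrib_left[symmetric] u by simp
      finally show ?thesis .
    qed
    with measure_cap_le_spread[OF u] have "measure lebesgue (cap u) < 1 / 3" by simp
    moreover have "(u $ k)\<^sup>2 \<noteq> 1" for k using lt[of k] by auto
    ultimately show ?thesis by auto
  next
    case True
    then obtain k where k: "9 / 16 \<le> (u $ k)\<^sup>2" by blast
    have small: "(u $ j)\<^sup>2 \<le> 1 - (u $ k)\<^sup>2" if "j \<noteq> k" for j
      using member_le_sum[of j "UNIV - {k}" "\<lambda>i. (u $ i)\<^sup>2"] that unfolding rest by simp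
    \<comment> \<open>The coordinates other than \<open>k\<close> have total square at most 7 / 16 <
      1 / 2.\<close>
    have small2: "(u $ i)\<^sup>2 + (u $ j)\<^sup>2 < 1 / 2" if "i \<noteq> j" "i \<noteq> k" "j \<noteq> k" for i j
    proof -
      have "(\<Sum>i\<in>{i, j}. (u $ i)\<^sup>2) \<le> (\<Sum>i\<in>UNIV - {k}. (u $ i)\<^sup>2)"
        using that by (intro sum_mono2) auto
      then show ?thesis using that k unfolding rest by simp
    qed
    have lt: "(u $ j)\<^sup>2 < (u $ k)\<^sup>2" if "j \<noteq> k" for j
      using small[OF that] k by linarith
    note le = measure_cap_le_peak[OF lt small2]
    show ?thesis
    proof (cases "(u $ k)\<^sup>2 < 1")
      case True
      have "measure lebesgue (cap u) < 1 / 3"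
        using le capfun_ratio_peak(2)[OF u k True] by simp
      moreover have "(u $ j)\<^sup>2 \<noteq> 1" for j
        using small[of j] True k by (cases "j = k") auto
      ultimately show ?thesis by auto
    next
      case False
      \<comment> \<open>Here \<open>u\<close> is an axis vector up to sign, and the upper and lower
        bounds meet at 1 / 3.\<close>
      have "(u $ k)\<^sup>2 = 1"
        using False rest[of k] sum_nonneg[of "UNIV - {k}" "\<lambda>i. (u $ i)\<^sup>2"] by simp
      moreover from this have "u $ j = 0" if "j \<noteq> k" for j
        using small[OF that] by simp
      ultimately have "1 / 3 \<le> measure lebesgue (cap u)"
        by (intro measure_cap_axis_ge[of _ k]) (auto simp: power2_eq_1_iff)
      moreover have "measure lebesgue (cap u) \<le> 1 / 3"
        using le capfun_ratio_peak(1)[OF u k] by simp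
      ultimately show ?thesis using \<open>(u $ k)\<^sup>2 = 1\<close> by auto
    qed
  qed
  then show ?thesis unfolding axis_iff cap_def .
qed

end
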